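(* Let $\rho^{(1)},\rho^{(2)}$ be finite positive Borel measures on the closed unit disc $\overline{\mathbb D}$. Let $S:\overline{\mathbb D}\to[0,1]$ be defined by $S(z)=|z|^2$, let $S_*\rho^{(i)}$ denote the pushforward of $\rho^{(i)}$ by $S$, and let $\delta_1$ denote the Dirac measure at $1$ on $[0,1]$. Then the Lévy measure $\nu_{(\mathscr M_z,1)}$ for $(\mathscr M_z,1)$, where $\mathscr M_z=(\mathscr M_{z_1},\mathscr M_{z_2})$ is the pair of multiplication operators by the coordinate functions on the Dirichlet-type space $\mathcal D(\rho^{(1)},\rho^{(2)})$ and $1$ is the constant function, is of the form $$d\nu_{(\mathscr M_z,1)}(x)=\frac{1}{1-x_1}\,d\big((S_*\rho^{(1)})\times\delta_1\big)(x)+\frac{1}{1-x_2}\,d\big(\delta_1\times(S_*\rho^{(2)})\big)(x)$$ on $[0,1]^2\setminus\{(1,1)\}$.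
   Context: $\mathbb D$ is the open unit disc in $\mathbb C$, $\mathbb T$ the unit circle, $dA$ the normalized Lebesgue area measure on $\mathbb D$, $\mathbb Z_+$ the nonnegative integers, $\mathbb R_+=[0,\infty)$. Superharmonic weight: for a finite positive Borel measure $\rho$ on $\overline{\mathbb D}$ and $z\in\mathbb D$, $$U_\rho(z)=\int_{\mathbb D}\log\left|\frac{1-\overline\zeta z}{z-\zeta}\right|^2\frac{d\rho(\zeta)}{1-|\zeta|^2}+\int_{\mathbb T}\frac{1-|z|^2}{|\zeta-z|^2}\,d\rho(\zeta).$$ Dirichlet-type space on the bidisc: $H^2(\mathbb D^2)$ is the Hardy space on $\mathbb D^2$ (holomorphic functions with square-summable Taylor coefficients, $\|f\|_{H^2(\mathbb D^2)}^2=\sum_{\alpha\in\mathbb Z_+^2}|\widehat f(\alpha)|^2$). Put $$D_{\rho^{(1)},\rho^{(2)}}(f)=\sup_{0<r<1}\int_0^{2\pi}\int_{\mathbb D}|\partial_1f(z_1,re^{i\theta})|^2U_{\rho^{(1)}}(z_1)\,dA(z_1)\frac{d\theta}{2\pi}+\sup_{0<r<1}\int_0^{2\pi}\int_{\mathbb D}|\partial_2f(re^{i\theta},z_2)|^2U_{\rho^{(2)}}(z_2)\,dA(z_2)\frac{d\theta}{2\pi},$$ $\mathcal D(\rho^{(1)},\rho^{(2)})=\{f\in H^2(\mathbb D^2):D_{\rho^{(1)},\rho^{(2)}}(f)<\infty\}$, with norm $\|f\|^2_{\mathcal D(\rho^{(1)},\rho^{(2)})}=\|f\|^2_{H^2(\mathbb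 D^2)}+D_{\rho^{(1)},\rho^{(2)}}(f)$. Completely alternating functions: for $\phi:\mathbb Z_+^d\to\mathbb R$ let $\nabla_i\phi(\alpha)=\phi(\alpha)-\phi(\alpha+\varepsilon(i))$, where $\varepsilon(i)$ is the $i$-th standard unit tuple, and $\nabla^\alpha=\nabla_1^{\alpha_1}\cdots\nabla_d^{\alpha_d}$. $\phi$ is completely alternating if $(\nabla^\alpha\phi)(\beta)\le0$ for all $\beta\in\mathbb Z_+^d$, $\alpha\in\mathbb Z_+^d\setminus\{0\}$. It is known that $\phi$ is completely alternating if and only if there are $a\in\mathbb R$, an additive map $b:\mathbb Z_+^d\to\mathbb R_+$ and a positive Radon measure $\nu$ on $[0,1]^d\setminus\{\mathbf 1\}$, $\mathbf 1=(1,\dots,1)$, with $\phi(\alpha)=a+b(\alpha)+\int_{[0,1]^d\setminus\{\mathbf 1\}}(1-x^\alpha)\,d\nu(x)$ for all $\alpha\in\mathbb Z_+^d\setminus\{0\}$, where $a=\phi(0)$ and $b(\alpha)=\lim_{n\to\infty}\phi(n\alpha)/n$; the triple $(a,b,\nu)$ is uniquely determined by $\phi$, and $\nu$ is called the Lévy measure for $\phi$. Completely hyperexpansive tuples: a commuting $d$-tuple $\mathbf T=(T_1,\dots,T_d)$ of bounded operators on a complex Hilbert space $\mathcal H$ is completely hyperexpansive if $\sum_{0\le\beta\le\alpha}(-1)^{|\beta|}\binom{\alpha}{\beta}\mathbf T^{*\beta}\mathbf T^\beta\le0$ for all $\alpha\in\mathbb Z_+^d\setminus\{0\}$; equivalently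 (known), for each $h\in\mathcal H$ the function $\alpha\mapsto\|\mathbf T^\alpha h\|^2$ is completely alternating. The Lévy measure of this function is called the Lévy measure for $(\mathbf T,h)$ and is denoted $\nu_{(\mathbf T,h)}$. It is known that $\mathscr M_z=(\mathscr M_{z_1},\mathscr M_{z_2})$ on $\mathcal D(\rho^{(1)},\rho^{(2)})$ is a completely hyperexpansive pair of bounded commuting operators, so $\nu_{(\mathscr M_z,1)}$ is the Lévy measure of $\alpha\mapsto\|z^\alpha\|^2_{\mathcal D(\rho^{(1)},\rho^{(2)})}$, $\alpha\in\mathbb Z_+^2$. *)

theory Defs
  imports "HOL-Probability.Probability"
begin

section \<open>The potential of a measure on the closed disc\<close>

definition finite_borel_measure_on_cdisc :: "complex measure \<Rightarrow> bool" where
  "finite_borel_measure_on_cdisc \<rho> \<longleftrightarrow>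
     sets \<rho> = sets (restrict_space borel (cball 0 1)) \<and> finite_measure \<rho>"

text \<open>The logarithmic kernel is infinite on the diagonal; HOL's \<open>ln (c / 0) = 0\<close> would
  give a finite value there, so the weight is taken in \<^typ>\<open>ennreal\<close>.\<close>

definition log_kernel :: "complex \<Rightarrow> complex \<Rightarrow> ennreal" where
  "log_kernel z \<zeta> =
     (if z = \<zeta> then \<infinity> else ennreal (ln ((cmod ((1 - cnj \<zeta> * z) / (z - \<zeta>)))\<^sup>2)))"

definition superharmonic_weight :: "complex measure \<Rightarrow> complex \<Rightarrow> ennreal" where
  "superharmonic_weight \<rho> z =
     (\<integral>\<^sup>+ \<zeta>\<in>ball 0 1. log_kernel z \<zeta> * ennreal (1 / (1 - (cmod \<zeta>)\<^sup>2)) \<partial>\<rho>)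
   + (\<integral>\<^sup>+ \<zeta>\<in>sphere 0 1. ennreal ((1 - (cmod z)\<^sup>2) / (cmod (\<zeta> - z))\<^sup>2) \<partial>\<rho>)"

section \<open>The Hardy space and Dirichlet-type spaces on the bidisc\<close>

text \<open>A function on the bidisc is an element of \<open>extensional bidisc\<close>, so that equality of
  elements of the spaces below is equality on the bidisc.\<close>

definition bidisc :: "(complex \<times> complex) set" where
  "bidisc = ball 0 1 \<times> ball 0 1"

definition holomorphic_on_bidisc :: "(complex \<times> complex \<Rightarrow> complex) \<Rightarrow> bool" where
  "holomorphic_on_bidisc f \<longleftrightarrow>
     (\<forall>z\<in>bidisc. \<exists>a b. (f has_derivative (\<lambda>h. a * fst h + b * snd h)) (at z))"

definition taylor_coeff :: "(complex \<times> complex \<Rightarrow> complex) \<Rightarrow> nat \<times> nat \<Rightarrow> complex" where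
  "taylor_coeff f \<alpha> =
     (deriv ^^ fst \<alpha>) (\<lambda>z1. (deriv ^^ snd \<alpha>) (\<lambda>z2. f (z1, z2)) 0) 0
       / (fact (fst \<alpha>) * fact (snd \<alpha>))"

definition hardy_space :: "(complex \<times> complex \<Rightarrow> complex) set" where
  "hardy_space = {f \<in> extensional bidisc. holomorphic_on_bidisc f \<and>
     (\<lambda>\<alpha>. (cmod (taylor_coeff f \<alpha>))\<^sup>2) summable_on UNIV}"

definition hardy_norm_sq :: "(complex \<times> complex \<Rightarrow> complex) \<Rightarrow> real" where
  "hardy_norm_sq f = (\<Sum>\<^sub>\<infinity>\<alpha>. (cmod (taylor_coeff f \<alpha>))\<^sup>2)"

abbreviation area_measure :: "complex measure" where
  "area_measure \<equiv> uniform_measure lborel (ball 0 1)"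

abbreviation angle_measure :: "real measure" where
  "angle_measure \<equiv> uniform_measure lborel {0..2 * pi}"

definition dirichlet_integral ::
  "complex measure \<Rightarrow> complex measure \<Rightarrow> (complex \<times> complex \<Rightarrow> complex) \<Rightarrow> ennreal" where
  "dirichlet_integral \<rho>1 \<rho>2 f =
     (SUP r\<in>{0<..<1}. \<integral>\<^sup>+ \<theta>. (\<integral>\<^sup>+ z1.
        ennreal ((cmod (deriv (\<lambda>w. f (w, rcis r \<theta>)) z1))\<^sup>2) * superharmonic_weight \<rho>1 z1
        \<partial>area_measure) \<partial>angle_measure)
   + (SUP r\<in>{0<..<1}. \<integral>\<^sup>+ \<theta>. (\<integral>\<^sup>+ z2.
        ennreal ((cmod (deriv (\<lambda>w. f (rcis r \<theta>, w)) z2))\<^sup>2) * superharmonic_weight \<rho>2 z2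
        \<partial>area_measure) \<partial>angle_measure)"

definition dirichlet_space ::
  "complex measure \<Rightarrow> complex measure \<Rightarrow> (complex \<times> complex \<Rightarrow> complex) set" where
  "dirichlet_space \<rho>1 \<rho>2 = {f \<in> hardy_space. dirichlet_integral \<rho>1 \<rho>2 f < \<infinity>}"

definition dirichlet_norm ::
  "complex measure \<Rightarrow> complex measure \<Rightarrow> (complex \<times> complex \<Rightarrow> complex) \<Rightarrow> real" where
  "dirichlet_norm \<rho>1 \<rho>2 f = sqrt (hardy_norm_sq f + enn2real (dirichlet_integral \<rho>1 \<rho>2 f))"

definition mult_z1 :: "(complex \<times> complex \<Rightarrow> complex) \<Rightarrow> (complex \<times> complex \<Rightarrow> complex)" where
  "mult_z1 f = (\<lambda>z\<in>bidisc. fst z * f z)"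

definition mult_z2 :: "(complex \<times> complex \<Rightarrow> complex) \<Rightarrow> (complex \<times> complex \<Rightarrow> complex)" where
  "mult_z2 f = (\<lambda>z\<in>bidisc. snd z * f z)"

definition one_fun :: "complex \<times> complex \<Rightarrow> complex" where
  "one_fun = (\<lambda>z\<in>bidisc. 1)"

section \<open>Completely alternating functions in two variables and their Levy measures\<close>

definition nabla :: "nat \<times> nat \<Rightarrow> (nat \<times> nat \<Rightarrow> real) \<Rightarrow> (nat \<times> nat \<Rightarrow> real)" where
  "nabla e \<phi> = (\<lambda>\<alpha>. \<phi> \<alpha> - \<phi> (\<alpha> + e))"

definition nabla_pow :: "nat \<times> nat \<Rightarrow> (nat \<times> nat \<Rightarrow> real) \<Rightarrow> (nat \<times> nat \<Rightarrow> real)" where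
  "nabla_pow \<alpha> \<phi> = (nabla (1, 0) ^^ fst \<alpha>) ((nabla (0, 1) ^^ snd \<alpha>) \<phi>)"

definition completely_alternating :: "(nat \<times> nat \<Rightarrow> real) \<Rightarrow> bool" where
  "completely_alternating \<phi> \<longleftrightarrow> (\<forall>\<alpha> \<beta>. \<alpha> \<noteq> 0 \<longrightarrow> nabla_pow \<alpha> \<phi> \<beta> \<le> 0)"

definition radon_measure_on :: "'a::t2_space set \<Rightarrow> 'a measure \<Rightarrow> bool" where
  "radon_measure_on X \<mu> \<longleftrightarrow>
     sets \<mu> = sets (restrict_space borel X) \<and>
     (\<forall>K. compact K \<and> K \<subseteq> X \<longrightarrow> emeasure \<mu> K < \<infinity>) \<and>
     (\<forall>B\<in>sets \<mu>. emeasure \<mu> B = (SUP K\<in>{K. compact K \<and> K \<subseteq> B}. emeasure \<mu> K))"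

definition punctured_square :: "(real \<times> real) set" where
  "punctured_square = {0..1} \<times> {0..1} - {(1, 1)}"

definition monomial :: "nat \<times> nat \<Rightarrow> real \<times> real \<Rightarrow> real" where
  "monomial \<alpha> x = fst x ^ fst \<alpha> * snd x ^ snd \<alpha>"

definition levy_measure_of :: "(nat \<times> nat \<Rightarrow> real) \<Rightarrow> (real \<times> real) measure \<Rightarrow> bool" where
  "levy_measure_of \<phi> \<nu> \<longleftrightarrow>
     completely_alternating \<phi> \<and>
     radon_measure_on punctured_square \<nu> \<and>
     (\<exists>a b. a = \<phi> 0 \<and>
        (\<forall>\<alpha>. 0 \<le> b \<alpha>) \<and> (\<forall>\<alpha> \<beta>. b (\<alpha> + \<beta>) = b \<alpha> + b \<beta>) \<and>
        (\<forall>\<alpha>. (\<lambda>n. \<phi> (n * fst \<alpha>, n * snd \<alpha>) / real n) \<longlonglongrightarrow> b \<alpha>) \<and>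
        (\<forall>\<alpha>. \<alpha> \<noteq> 0 \<longrightarrow> integrable \<nu> (\<lambda>x. 1 - monomial \<alpha> x) \<and>
               \<phi> \<alpha> = a + b \<alpha> + (\<integral>x. 1 - monomial \<alpha> x \<partial>\<nu>)))"

text \<open>The Levy measure for \<open>(T, h)\<close>, where \<open>T = (T1, T2)\<close> is a pair of operators on a space
  with carrier \<open>H\<close> and norm \<open>nrm\<close>. The norm is meaningful only on \<open>H\<close>, hence the
  requirement that the orbit of \<open>h\<close> stay in \<open>H\<close>.\<close>

definition levy_measure_of_pair ::
  "'f set \<Rightarrow> ('f \<Rightarrow> real) \<Rightarrow> ('f \<Rightarrow> 'f) \<times> ('f \<Rightarrow> 'f) \<Rightarrow> 'f \<Rightarrow> (real \<times> real) measure \<Rightarrow> bool" where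
  "levy_measure_of_pair H nrm T h \<nu> \<longleftrightarrow>
     (\<forall>\<alpha>. (fst T ^^ fst \<alpha>) ((snd T ^^ snd \<alpha>) h) \<in> H) \<and>
     levy_measure_of (\<lambda>\<alpha>. (nrm ((fst T ^^ fst \<alpha>) ((snd T ^^ snd \<alpha>) h)))\<^sup>2) \<nu>"

definition add_measure :: "'a measure \<Rightarrow> 'a measure \<Rightarrow> 'a measure" where
  "add_measure M N = measure_of (space M) (sets M) (\<lambda>A. emeasure M A + emeasure N A)"

end

theory Submission
  imports Defs "HOL-Complex_Analysis.Complex_Analysis"
begin

text \<open>
  Averaging over rotations turns the Dirichlet integral of \<open>z\<^sup>n\<close> into a radial one: the circle means of
  the logarithmic kernel are \<open>- ln (max (|z|\<^sup>2) (|\<zeta>|\<^sup>2))\<close> and those of the Poisson kernel are \<open>1\<close>, so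
  that integrating \<open>n\<^sup>2 |z|\<^bsup>2(n-1)\<^esup>\<close> against the potential of a point mass at \<open>\<zeta>\<close> gives
  \<open>1 + |\<zeta>|\<^sup>2 + \<dots> + |\<zeta>|\<^bsup>2(n-1)\<^esup>\<close>, both for \<open>\<zeta>\<close> inside the disc and on the circle. Hence the squared
  norm of \<open>z\<^sup>\<alpha>\<close> is \<open>1\<close> plus the sums of the first \<open>\<alpha>\<^sub>1\<close> and \<open>\<alpha>\<^sub>2\<close> moments of the pushforwards of the two
  measures under \<open>|z|\<^sup>2\<close>. In the Levy representation the mass at \<open>1\<close> of a pushforward produces the
  additive part, and the rest, divided by \<open>1 - x\<close>, the part of the Levy measure on an edge of the
  square.
\<close>

section \<open>Measures on the unit square determined by their moments\<close>

text \<open>The claim is an equivalence for an arbitrary \<open>\<nu>\<close>: the edge measure must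
  satisfy \<open>levy_measure_of\<close>, and nothing else may. The obstacle to uniqueness is that a
  Levy measure can be infinite near (1,1), so that its own moments may be infinite; after
  multiplication by a weight vanishing there, Stone-Weierstrass on the compact square settles the
  finite case. The factor 1/(1 - x) has its origin in a geometric sum: 1 + x + ... + x^(n-1) is (1 -
  x^n)/(1 - x) for x < 1, but n, hence linear in n, at x = 1. On the analytic side polar coordinates
  are replaced by two facts: area measure is invariant under rotations, and its image under |z|^2 is
  uniform on [0,1], so radial integrals become elementary in t = |z|^2. The disc integrals are taken
  in \<open>ennreal\<close>, so Tonelli needs no integrability check although the logarithmic kernel
  is infinite on the diagonal.\<close>

inductive monomial_combination :: "(real \<times> real \<Rightarrow> real) \<Rightarrow> bool" where
  base: "monomial_combination (\<lambda>x. c * monomial \<alpha> x)"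
| add: "monomial_combination f \<Longrightarrow> monomial_combination g \<Longrightarrow> monomial_combination (\<lambda>x. f x + g x)"

lemma monomial_mult: "monomial \<alpha> x * monomial \<beta> x = monomial (\<alpha> + \<beta>) x"
  by (simp add: monomial_def power_add)

lemma continuous_on_monomial: "continuous_on A (monomial \<alpha>)"
  unfolding monomial_def by (intro continuous_intros)

lemma borel_measurable_monomial [measurable]: "monomial \<alpha> \<in> borel_measurable borel"
  by (intro borel_measurable_continuous_onI continuous_on_monomial)

text \<open>Products of monomials are monomials, so a double induction suffices. This makes the
  combinations an algebra, as Stone-Weierstrass requires.\<close>

lemma monomial_combination_mult:
  assumes "monomial_combination f" "monomial_combination g"
  shows "monomial_combination (\<lambda>x. f x * g x)"
  using assms(1)
proof induction
  case (base c \<alpha>)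
  show ?case using assms(2)
  proof induction
    case (base d \<beta>)
    have "(\<lambda>x. c * monomial \<alpha> x * (d * monomial \<beta> x)) = (\<lambda>x. (c * d) * monomial (\<alpha> + \<beta>) x)"
      by (simp add: monomial_mult[symmetric] mult_ac)
    then show ?case by (simp only: monomial_combination.base)
  next
    case (add f g)
    then show ?case by (simp only: distrib_left monomial_combination.add)
  qed
next
  case (add f g)
  then show ?case by (simp only: distrib_right monomial_combination.add)
qed

lemma continuous_on_monomial_combination:
  "monomial_combination f \<Longrightarrow> continuous_on A f"
  by (induction rule: monomial_combination.induct)
     (auto intro!: continuous_intros continuous_on_monomial)

text \<open>Stone-Weierstrass: constants have exponent (0,0), and the coordinate functions, with
  exponents (1,0) and (0,1), separate points.\<close>

lemma monomial_combination_dense: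
  assumes "continuous_on ({0..1} \<times> {0..1}) f" "0 < e"
  obtains p where "monomial_combination p" "\<And>x. x \<in> {0..1} \<times> {0..1} \<Longrightarrow> \<bar>f x - p x\<bar> < e"
proof -
  have "\<exists>g. monomial_combination g \<and> (\<forall>x\<in>{0..1} \<times> {0..1}. \<bar>f x - g x\<bar> < e)"
  proof (rule Stone_Weierstrass_HOL)
    show "compact ({0..1::real} \<times> {0..1::real})" by (intro compact_Times compact_Icc)
    show "monomial_combination (\<lambda>x. c)" for c
      using monomial_combination.base[of c "(0,0)"] by (simp add: monomial_def)
    show "\<exists>p. monomial_combination p \<and> p x \<noteq> p y"
      if "x \<in> {0..1} \<times> {0..1} \<and> y \<in> {0..1} \<times> {0..1} \<and> x \<noteq> y" for x y
    proof -
      have "monomial_combination fst" "monomial_combination snd"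
        using monomial_combination.base[of 1 "(1,0)"] monomial_combination.base[of 1 "(0,1)"]
        by (simp_all add: monomial_def)
      moreover have "fst x \<noteq> fst y \<or> snd x \<noteq> snd y" using that by (auto simp: prod_eq_iff)
      ultimately show ?thesis by blast
    qed
    show "continuous_on ({0..1} \<times> {0..1}) p" if "monomial_combination p" for p
      by (rule continuous_on_monomial_combination[OF that])
    show "monomial_combination (\<lambda>x. p x + q x)" "monomial_combination (\<lambda>x. p x * q x)"
      if "monomial_combination p \<and> monomial_combination q" for p q
      using that monomial_combination.add[of p q] monomial_combination_mult[of p q] by blast+
  qed (use assms in auto)
  then show ?thesis using that by blast
qed

lemma integrable_continuous_square:
  fixes M :: "(real \<times> real) measure"
  assumes "finite_measure M" "sets M = sets borel" "AE x in M. x \<in> {0..1} \<times> {0..1}"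
    and f: "continuous_on UNIV f"
  shows "integrable M (f :: _ \<Rightarrow> real)"
proof -
  interpret finite_measure M by fact
  have "compact (f ` ({0..1} \<times> {0..1}))"
    by (intro compact_continuous_image continuous_on_subset[OF f] compact_Times compact_Icc) auto
  then obtain B where "\<And>x. x \<in> {0..1} \<times> {0..1} \<Longrightarrow> norm (f x) \<le> B"
    by (meson bounded_iff compact_imp_bounded imageI)
  with assms(3) have "AE x in M. norm (f x) \<le> B" by fastforce
  moreover have "f \<in> borel_measurable M"
    using borel_measurable_continuous_onI[OF f] assms(2) measurable_cong_sets by blast
  ultimately show ?thesis by (rule integrable_const_bound)
qed

text \<open>The approximation is uniform only on the square, but both measures are carried by it, so
  replacing \<open>f\<close> by \<open>p\<close> costs at most the tolerance times the total
  mass.\<close>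

lemma integral_eq_of_moments_eq:
  fixes M N :: "(real \<times> real) measure"
  assumes M: "finite_measure M" "sets M = sets borel" "AE x in M. x \<in> {0..1} \<times> {0..1}"
    and N: "finite_measure N" "sets N = sets borel" "AE x in N. x \<in> {0..1} \<times> {0..1}"
    and eq: "\<And>\<alpha>. (\<integral>x. monomial \<alpha> x \<partial>M) = (\<integral>x. monomial \<alpha> x \<partial>N)"
    and f: "continuous_on UNIV f"
  shows "(\<integral>x. f x \<partial>M) = (\<integral>x. (f x :: real) \<partial>N)"
proof -
  interpret M: finite_measure M by fact
  interpret N: finite_measure N by fact
  note intM = integrable_continuous_square[OF M] and intN = integrable_continuous_square[OF N]
  note cont = continuous_on_monomial_combination[of _ UNIV]
  have comb: "(\<integral>x. p x \<partial>M) = (\<integral>x. p x \<partial>N)" if "monomial_combination p" for p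
    using that
  proof induction
    case (add p q)
    then show ?case
      by (simp add: Bochner_Integration.integral_add[OF intM[OF cont] intM[OF cont]]
          Bochner_Integration.integral_add[OF intN[OF cont] intN[OF cont]])
  qed (simp add: eq)
  \<comment> \<open>The summand 1 keeps \<open>C\<close> positive when both measures vanish; with
    tolerance \<open>e / C\<close> the two errors add up to at most \<open>e\<close>.\<close>
  define C where "C = measure M (space M) + measure N (space N) + 1"
  have "C > 0" by (simp add: C_def add_nonneg_pos)
  have close: "\<bar>(\<integral>x. f x \<partial>L) - (\<integral>x. p x \<partial>L)\<bar> \<le> e * measure L (space L)"
    if L: "finite_measure L" "sets L = sets borel" "AE x in L. x \<in> {0..1} \<times> {0..1}"
      and p: "monomial_combination p" "\<And>x. x \<in> {0..1} \<times> {0..1} \<Longrightarrow> \<bar>f x - p x\<bar> < e"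
    for L p e
  proof -
    interpret L: finite_measure L by fact
    note int = integrable_continuous_square[OF L]
    have "\<bar>\<integral>x. f x - p x \<partial>L\<bar> \<le> (\<integral>x. \<bar>f x - p x\<bar> \<partial>L)"
      by (rule integral_abs_bound)
    also have "\<dots> \<le> (\<integral>x. e \<partial>L)"
    proof (rule integral_mono_AE)
      show "integrable L (\<lambda>x. \<bar>f x - p x\<bar>)"
        by (intro integrable_abs Bochner_Integration.integrable_diff int f cont[OF p(1)])
      show "AE x in L. \<bar>f x - p x\<bar> \<le> e" using L(3) p(2) by (force intro: less_imp_le)
    qed simp
    finally show ?thesis
      by (simp add: Bochner_Integration.integral_diff[OF int[OF f] int[OF cont[OF p(1)]]] mult.commute)
  qed
  have "\<bar>(\<integral>x. f x \<partial>M) - (\<integral>x. f x \<partial>N)\<bar> \<le> 0 + e" if "e > 0" for e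
  proof -
    from monomial_combination_dense[OF continuous_on_subset[OF f], of "e / C"] that \<open>C > 0\<close>
    obtain p where p: "monomial_combination p"
        "\<And>x. x \<in> {0..1} \<times> {0..1} \<Longrightarrow> \<bar>f x - p x\<bar> < e / C"
      by auto
    have "\<bar>(\<integral>x. f x \<partial>M) - (\<integral>x. f x \<partial>N)\<bar> \<le>
        e / C * measure M (space M) + e / C * measure N (space N)"
      using close[OF M p] close[OF N p] comb[OF p(1)] by linarith
    also have "\<dots> \<le> e / C * C"
      unfolding distrib_left[symmetric] using that \<open>C > 0\<close>
      by (intro mult_left_mono) (auto simp: C_def)
    finally show ?thesis using \<open>C > 0\<close> by simp
  qed
  then have "\<bar>(\<integral>x. f x \<partial>M) - (\<integral>x. f x \<partial>N)\<bar> \<le> 0" by (rule field_le_epsilon)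
  then show ?thesis by simp
qed

text \<open>Closed sets form an intersection-stable generator of the Borel sets, and the indicator
  of a closed set is a bounded pointwise limit of continuous functions.\<close>

lemma measure_eqI_continuous:
  fixes M N :: "'a::metric_space measure"
  assumes M: "finite_measure M" "sets M = sets borel"
    and N: "finite_measure N" "sets N = sets borel"
    and eq: "\<And>f :: 'a \<Rightarrow> real. continuous_on UNIV f \<Longrightarrow> (\<And>x. 0 \<le> f x \<and> f x \<le> 1) \<Longrightarrow>
      (\<integral>x. f x \<partial>M) = (\<integral>x. f x \<partial>N)"
  shows "M = N"
proof (rule measure_eqI_generator_eq[where \<Omega> = UNIV and E = "Collect closed" and A = "\<lambda>_. UNIV"])
  interpret M: finite_measure M by fact
  interpret N: finite_measure N by fact
  show "emeasure M X = emeasure N X" if "X \<in> Collect closed" for X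
  \<comment> \<open>\<open>infdist\<close> to the empty set is 0 by convention, so there the
    functions \<open>f n\<close> would be constantly 1 instead of tending to the indicator.\<close>
  proof (cases "X = {}")
    case False
    define f where "f n x = max 0 (1 - real n * infdist x X)" for n x
    have cont: "continuous_on UNIV (f n)" for n
      unfolding f_def by (intro continuous_intros)
    have bounds: "0 \<le> f n x \<and> f n x \<le> 1" for n x
      unfolding f_def by (auto simp: infdist_nonneg)
    have lim: "(\<lambda>n. f n x) \<longlonglongrightarrow> indicator X x" for x
    proof (cases "x \<in> X")
      case False
      have pos: "infdist x X > 0"
        using that False \<open>X \<noteq> {}\<close> by (intro infdist_pos_not_in_closed) auto
      obtain n0 where n0: "1 / infdist x X \<le> real n0" using real_arch_simple by blast
      have "f n x = 0" if "n \<ge> n0" for n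
      proof -
        have "1 / infdist x X \<le> real n" using n0 that by linarith
        with pos show ?thesis by (simp add: f_def field_simps)
      qed
      then have "\<forall>\<^sub>F n in sequentially. f n x = indicator X x"
        unfolding eventually_sequentially using False by auto
      then show ?thesis by (rule tendsto_eventually)
    qed (simp add: f_def)
    have conv: "(\<lambda>n. \<integral>x. f n x \<partial>L) \<longlonglongrightarrow> measure L X"
      if L: "finite_measure L" "sets L = sets borel" for L
    proof -
      interpret L: finite_measure L by fact
      have X: "X \<in> sets L" using \<open>X \<in> Collect closed\<close> L by auto
      have "f n \<in> borel_measurable L" for n
        using borel_measurable_continuous_onI[OF cont] L(2) measurable_cong_sets by blast
      then have "(\<lambda>n. \<integral>x. f n x \<partial>L) \<longlonglongrightarrow> (\<integral>x. indicator X x \<partial>L)"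
        by (intro integral_dominated_convergence[where w = "\<lambda>_. 1"])
           (use lim bounds X in auto)
      also have "(\<integral>x. indicator X x \<partial>L) = measure L X"
        using X sets.sets_into_space[OF X] by (simp add: Int_absorb2)
      finally show ?thesis .
    qed
    have "measure M X = measure N X"
      by (rule LIMSEQ_unique[OF conv[OF M]]) (use conv[OF N] eq[OF cont bounds] in simp)
    then show ?thesis by (simp add: M.emeasure_eq_measure N.emeasure_eq_measure)
  qed simp
  show "Int_stable (Collect closed :: 'a set set)" by (auto intro!: Int_stableI)
  show "sets M = sigma_sets UNIV (Collect closed)" "sets N = sigma_sets UNIV (Collect closed)"
    unfolding M(2) N(2) borel_eq_closed by (rule sets_measure_of, simp)+
  show "emeasure M UNIV \<noteq> \<infinity>" for i :: nat
    by (simp add: M.emeasure_eq_measure)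
  show "Collect closed \<subseteq> Pow (UNIV :: 'a set)" by blast
  show "range (\<lambda>_::nat. UNIV :: 'a set) \<subseteq> Collect closed" by blast
  show "(\<Union>i::nat. UNIV) = (UNIV :: 'a set)" by blast
qed

lemma measure_eqI_moments:
  fixes M N :: "(real \<times> real) measure"
  assumes "finite_measure M" "sets M = sets borel" "AE x in M. x \<in> {0..1} \<times> {0..1}"
    and "finite_measure N" "sets N = sets borel" "AE x in N. x \<in> {0..1} \<times> {0..1}"
    and "\<And>\<alpha>. (\<integral>x. monomial \<alpha> x \<partial>M) = (\<integral>x. monomial \<alpha> x \<partial>N)"
  shows "M = N"
  by (rule measure_eqI_continuous[OF assms(1,2,4,5)]) (rule integral_eq_of_moments_eq[OF assms])

section \<open>Uniqueness of the Levy measure\<close>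

lemma borel_punctured_square [measurable]: "punctured_square \<in> sets borel"
proof -
  have "({0..1} \<times> {0..1} :: (real \<times> real) set) \<in> sets borel"
    by (intro borel_closed closed_Times closed_atLeastAtMost)
  then show ?thesis unfolding punctured_square_def by auto
qed

lemma monomial_le_1:
  assumes "x \<in> {0..1} \<times> {0..1}"
  shows "0 \<le> monomial \<alpha> x" "monomial \<alpha> x \<le> 1"
  using assms by (auto simp: monomial_def intro!: mult_le_one power_le_one)

lemma monomial_1_1_less:
  assumes "x \<in> punctured_square"
  shows "monomial (1, 1) x < 1"
proof -
  have "fst x * snd x \<noteq> 1"
  proof
    assume *: "fst x * snd x = 1"
    moreover have "fst x * snd x \<le> fst x * 1" "fst x * snd x \<le> 1 * snd x"
      using assms by (auto simp: punctured_square_def intro: mult_left_le mult_left_le_one_le)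
    ultimately have "fst x = 1" "snd x = 1"
      using assms by (auto simp: punctured_square_def)
    then show False using assms by (cases x) (simp add: punctured_square_def)
  qed
  moreover have "monomial (1, 1) x \<le> 1"
    using assms by (intro monomial_le_1) (auto simp: punctured_square_def)
  ultimately show ?thesis by (auto simp: monomial_def)
qed

text \<open>The integrand is a difference of two Levy integrands, with exponents
  \<open>\<beta> + \<gamma>\<close> and \<open>\<beta>\<close>. Subtracting the two formulas cancels
  \<open>\<phi> 0\<close>, and additivity leaves \<open>b \<gamma>\<close>.\<close>

lemma nabla_integral_levy:
  assumes int: "\<And>\<alpha>. \<alpha> \<noteq> 0 \<Longrightarrow> integrable \<nu> (\<lambda>x. 1 - monomial \<alpha> x)"
    and eq: "\<And>\<alpha>. \<alpha> \<noteq> 0 \<Longrightarrow> \<phi> \<alpha> = \<phi> 0 + b \<alpha> + (\<integral>x. 1 - monomial \<alpha> x \<partial>\<nu>)"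
    and b: "\<And>\<alpha> \<beta>. b (\<alpha> + \<beta>) = b \<alpha> + b \<beta>"
    and "\<gamma> \<noteq> 0"
  shows "(\<integral>x. (1 - monomial \<gamma> x) * monomial \<beta> x \<partial>\<nu>) = \<phi> (\<beta> + \<gamma>) - \<phi> \<beta> - b \<gamma>"
\<comment> \<open>The Levy formula is given only at nonzero arguments, so this case uses it at
  \<open>\<gamma>\<close> alone.\<close>
proof (cases "\<beta> = 0")
  case True
  then show ?thesis using eq[OF \<open>\<gamma> \<noteq> 0\<close>] by (simp add: monomial_def)
next
  case False
  have ne: "\<beta> + \<gamma> \<noteq> 0" using False by (auto simp: prod_eq_iff)
  have "(\<lambda>x. (1 - monomial \<gamma> x) * monomial \<beta> x) =
      (\<lambda>x. (1 - monomial (\<beta> + \<gamma>) x) - (1 - monomial \<beta> x))"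
    by (simp add: monomial_mult[symmetric] algebra_simps)
  then show ?thesis
    using Bochner_Integration.integral_diff[OF int[OF ne] int[OF False]] eq[OF ne] eq[OF False]
    by (simp add: b)
qed

text \<open>The weight \<open>1 - x\<^sub>1 x\<^sub>2\<close> vanishes on the closed square only at \<open>(1, 1)\<close>. Multiplying a
  Levy measure by it gives a finite measure whose moments are differences of \<open>\<phi>\<close>, and no mass is
  lost.\<close>

lemma levy_measure_unique:
  assumes "levy_measure_of \<phi> \<nu>" "levy_measure_of \<phi> \<nu>'"
  shows "\<nu> = \<nu>'"
proof -
  let ?w = "\<lambda>x. 1 - monomial (1, 1) x"
  \<comment> \<open>The image under the identity only replaces the trace sigma-algebra on the
    punctured square by \<open>borel\<close>, the setting of
    \<open>measure_eqI_moments\<close>.\<close>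
  define wt :: "(real \<times> real) measure \<Rightarrow> (real \<times> real) measure" where
    "wt L = distr (density L (\<lambda>x. ennreal (?w x))) borel (\<lambda>x. x)" for L
  \<comment> \<open>The slope along the diagonal is read off from \<open>\<phi>\<close> alone, hence
    is the same number for both measures; it equals \<open>b (1, 1)\<close> for either additive
    part.\<close>
  define c where "c = lim (\<lambda>n. \<phi> (n, n) / real n)"
  have weighted: "finite_measure (wt L) \<and> sets (wt L) = sets borel \<and>
      (AE x in wt L. x \<in> {0..1} \<times> {0..1}) \<and>
      (\<forall>\<beta>. (\<integral>x. monomial \<beta> x \<partial>wt L) = \<phi> (\<beta> + (1, 1)) - \<phi> \<beta> - c) \<and>
      (\<forall>B\<in>sets L. emeasure L B =
        (\<integral>\<^sup>+x. ennreal (1 / ?w x) * indicator B x \<partial>wt L)) \<and>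
      sets L = sets (restrict_space borel punctured_square)"
    if L: "levy_measure_of \<phi> L" for L
  proof -
    have sets [measurable_cong]: "sets L = sets (restrict_space borel punctured_square)"
      using L by (simp add: levy_measure_of_def radon_measure_on_def)
    have space: "space L = punctured_square"
      using sets_eq_imp_space_eq[OF sets] by (simp add: space_restrict_space)
    obtain b where b_add: "\<And>\<alpha> \<beta>. b (\<alpha> + \<beta>) = b \<alpha> + b \<beta>"
      and b_lim: "\<And>\<alpha>. (\<lambda>n. \<phi> (n * fst \<alpha>, n * snd \<alpha>) / real n) \<longlonglongrightarrow> b \<alpha>"
      and int: "\<And>\<alpha>. \<alpha> \<noteq> 0 \<Longrightarrow> integrable L (\<lambda>x. 1 - monomial \<alpha> x)"
      and eq: "\<And>\<alpha>. \<alpha> \<noteq> 0 \<Longrightarrow> \<phi> \<alpha> = \<phi> 0 + b \<alpha> + (\<integral>x. 1 - monomial \<alpha> x \<partial>L)"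
      using L unfolding levy_measure_of_def by blast
    have "b (1, 1) = c"
      unfolding c_def using b_lim[of "(1, 1)"] by (simp add: limI)
    have meas [measurable]: "(\<lambda>x. x) \<in> L \<rightarrow>\<^sub>M borel"
      unfolding measurable_cong_sets[OF sets refl] by (rule measurable_restrict_space1) simp
    have w_pos: "0 < ?w x" if "x \<in> space L" for x
      using monomial_1_1_less[of x] that by (simp add: space)
    have "finite_measure (wt L)"
    proof
      have "emeasure (wt L) (space (wt L)) = (\<integral>\<^sup>+x. ennreal (?w x) \<partial>L)"
        by (simp add: wt_def emeasure_distr emeasure_density cong: nn_integral_cong)
      also have "\<dots> = ennreal (\<integral>x. ?w x \<partial>L)"
        using w_pos by (intro nn_integral_eq_integral int AE_I2) (auto simp: less_imp_le prod_eq_iff)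
      finally show "emeasure (wt L) (space (wt L)) \<noteq> \<infinity>" by simp
    qed
    moreover have "AE x in wt L. x \<in> {0..1} \<times> {0..1}"
    proof -
      have "closed ({0..1} \<times> {0..1} :: (real \<times> real) set)"
        by (intro closed_Times closed_atLeastAtMost)
      then have [measurable]: "({0..1} \<times> {0..1} :: (real \<times> real) set) \<in> sets borel"
        by (rule borel_closed)
      have "AE x in L. x \<in> {0..1} \<times> {0..1}"
        by (rule AE_I2) (auto simp: space punctured_square_def)
      then show ?thesis
        unfolding wt_def by (subst AE_distr_iff) (auto simp: AE_density elim: AE_mp)
    qed
    moreover have "(\<integral>x. monomial \<beta> x \<partial>wt L) = \<phi> (\<beta> + (1, 1)) - \<phi> \<beta> - c" for \<beta>
    proof -
      have "(\<integral>x. monomial \<beta> x \<partial>wt L) = (\<integral>x. ?w x * monomial \<beta> x \<partial>L)"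
      proof -
        have "AE x in L. 0 \<le> ?w x" using w_pos by (intro AE_I2) (simp add: less_imp_le)
        then show ?thesis
          unfolding wt_def by (subst integral_distr, measurable, subst integral_density) auto
      qed
      also have "\<dots> = \<phi> (\<beta> + (1, 1)) - \<phi> \<beta> - b (1, 1)"
        by (rule nabla_integral_levy[OF int eq b_add]) (auto simp: prod_eq_iff)
      finally show ?thesis using \<open>b (1, 1) = c\<close> by simp
    qed
    \<comment> \<open>The weight is positive on the punctured square and can be divided out again,
      so \<open>wt L\<close> determines \<open>L\<close>.\<close>
    moreover have "emeasure L B = (\<integral>\<^sup>+x. ennreal (1 / ?w x) * indicator B x \<partial>wt L)"
      if "B \<in> sets L" for B
    proof -
      have [measurable]: "B \<in> sets borel"
        using that sets by (auto simp: sets_restrict_space)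
      have "(\<integral>\<^sup>+x. ennreal (1 / ?w x) * indicator B x \<partial>wt L) =
          (\<integral>\<^sup>+x. ennreal (?w x) * (ennreal (1 / ?w x) * indicator B x) \<partial>L)"
        by (simp add: wt_def nn_integral_distr nn_integral_density)
      also have "\<dots> = (\<integral>\<^sup>+x. indicator B x \<partial>L)"
      proof (rule nn_integral_cong)
        fix x assume "x \<in> space L"
        then have "ennreal (?w x) * ennreal (1 / ?w x) = 1"
          using w_pos[of x] by (simp add: ennreal_mult'[symmetric])
        then show "ennreal (?w x) * (ennreal (1 / ?w x) * indicator B x) = indicator B x"
          by (simp add: mult.assoc[symmetric])
      qed
      finally show ?thesis using that by simp
    qed
    ultimately show ?thesis using sets by (simp add: wt_def)
  qed
  have "wt \<nu> = wt \<nu>'"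
  proof (rule measure_eqI_moments)
    show "(\<integral>x. monomial \<beta> x \<partial>wt \<nu>) = (\<integral>x. monomial \<beta> x \<partial>wt \<nu>')" for \<beta>
      using weighted[OF assms(1)] weighted[OF assms(2)] by metis
  qed (use weighted[OF assms(1)] weighted[OF assms(2)] in blast)+
  then show ?thesis
    using weighted[OF assms(1)] weighted[OF assms(2)] by (intro measure_eqI) simp_all
qed

section \<open>Levy measures carried by two edges of the square\<close>

lemma emeasure_add_measure:
  assumes "sets N = sets M" "A \<in> sets M"
  shows "emeasure (add_measure M N) A = emeasure M A + emeasure N A"
proof -
  have "countably_additive (sets M) (\<lambda>A. emeasure M A + emeasure N A)"
  proof (rule countably_additiveI)
    fix F :: "nat \<Rightarrow> _" assume "range F \<subseteq> sets M" "disjoint_family F" "\<Union> (range F) \<in> sets M"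
    then show "(\<Sum>i. emeasure M (F i) + emeasure N (F i)) =
        emeasure M (\<Union> (range F)) + emeasure N (\<Union> (range F))"
      using assms(1) by (simp add: suminf_add[symmetric] suminf_emeasure)
  qed
  then show ?thesis
    unfolding add_measure_def
    by (intro emeasure_measure_of_sigma) (use assms in \<open>auto simp: positive_def sets.sigma_algebra_axioms\<close>)
qed

lemma sets_add_measure [simp, measurable_cong]: "sets (add_measure M N) = sets M"
  by (simp add: add_measure_def)

lemma nn_integral_add_measure:
  assumes sets: "sets N = sets M" and f: "f \<in> borel_measurable M"
  shows "(\<integral>\<^sup>+x. f x \<partial>add_measure M N) = (\<integral>\<^sup>+x. f x \<partial>M) + (\<integral>\<^sup>+x. f x \<partial>N)"
  using f
proof induction
  have [measurable_cong]: "sets N = sets M" by (fact sets)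
  have space: "space N = space M" "space (add_measure M N) = space M"
    by (rule sets_eq_imp_space_eq, simp add: sets)+
  {
    case (cong f g)
    then show ?case by (simp add: space cong: nn_integral_cong_simp)
  next
    case (set A)
    then show ?case by (simp add: sets emeasure_add_measure)
  next
    case (mult u c)
    then show ?case by (simp add: nn_integral_cmult distrib_left)
  next
    case (add u v)
    then show ?case by (simp add: nn_integral_add ac_simps)
  next
    case (seq U)
    have "(\<integral>\<^sup>+x. (SUP i. U i x) \<partial>L) = (SUP i. \<integral>\<^sup>+x. U i x \<partial>L)" if "sets L = sets M" for L
      using seq that by (intro nn_integral_monotone_convergence_SUP) (simp_all cong: measurable_cong_sets)
    \<comment> \<open>Both sequences of integrals increase, which is what allows the supremum of
      their sums to be split.\<close>
    moreover have "incseq (\<lambda>i. \<integral>\<^sup>+x. U i x \<partial>L)" for L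
      using seq(3) by (intro incseq_SucI nn_integral_mono) (auto dest: incseq_SucD le_funD)
    ultimately show ?case
      by (simp add: SUP_apply sets seq image_comp ennreal_SUP_add[symmetric])
  }
qed

lemma sets_borel_prod [simp]:
  "sets (borel \<Otimes>\<^sub>M borel) =
    sets (borel :: ('a::second_countable_topology \<times> 'b::second_countable_topology) measure)"
  by (subst borel_prod) (rule refl)

lemma nn_integral_pair_return_right:
  assumes "sigma_finite_measure M" and [measurable]: "f \<in> borel_measurable (M \<Otimes>\<^sub>M borel)"
  shows "(\<integral>\<^sup>+x. f x \<partial>(M \<Otimes>\<^sub>M return borel a)) = (\<integral>\<^sup>+x. f (x, a) \<partial>M)"
proof -
  interpret M: sigma_finite_measure M by fact
  interpret R: prob_space "return borel a" by (rule prob_space_return) simp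
  have sets: "sets (M \<Otimes>\<^sub>M return borel a) = sets (M \<Otimes>\<^sub>M borel)"
    by (intro sets_pair_measure_cong) simp_all
  have "(\<integral>\<^sup>+x. f x \<partial>(M \<Otimes>\<^sub>M return borel a)) = (\<integral>\<^sup>+x. \<integral>\<^sup>+y. f (x, y) \<partial>return borel a \<partial>M)"
    by (rule R.nn_integral_fst[symmetric]) (simp add: measurable_cong_sets[OF sets refl])
  also have "\<dots> = (\<integral>\<^sup>+x. f (x, a) \<partial>M)"
    by (intro nn_integral_cong nn_integral_return) simp_all
  finally show ?thesis .
qed

lemma nn_integral_pair_return_left:
  assumes "sigma_finite_measure M" and [measurable]: "f \<in> borel_measurable (borel \<Otimes>\<^sub>M M)"
  shows "(\<integral>\<^sup>+x. f x \<partial>(return borel a \<Otimes>\<^sub>M M)) = (\<integral>\<^sup>+y. f (a, y) \<partial>M)"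
proof -
  interpret M: sigma_finite_measure M by fact
  have sets: "sets (return borel a \<Otimes>\<^sub>M M) = sets (borel \<Otimes>\<^sub>M M)"
    by (intro sets_pair_measure_cong) simp_all
  have "(\<integral>\<^sup>+x. f x \<partial>(return borel a \<Otimes>\<^sub>M M)) = (\<integral>\<^sup>+x. \<integral>\<^sup>+y. f (x, y) \<partial>M \<partial>return borel a)"
    by (rule M.nn_integral_fst[symmetric]) (simp add: measurable_cong_sets[OF sets refl])
  also have "\<dots> = (\<integral>\<^sup>+y. f (a, y) \<partial>M)"
    by (intro nn_integral_return) simp_all
  finally show ?thesis .
qed

text \<open>The measure of the theorem with arbitrary \<open>M\<close> and \<open>N\<close> in place
  of the pushforwards. The restriction removes (1,1), the only point of the two edges at which the
  relevant density is singular.\<close>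

definition edge_measure :: "real measure \<Rightarrow> real measure \<Rightarrow> (real \<times> real) measure" where
  "edge_measure M N = add_measure
     (density (restrict_space (M \<Otimes>\<^sub>M return borel 1) punctured_square)
        (\<lambda>x. ennreal (1 / (1 - fst x))))
     (density (restrict_space (return borel 1 \<Otimes>\<^sub>M N) punctured_square)
        (\<lambda>x. ennreal (1 / (1 - snd x))))"

section \<open>Moments of a finite measure on the unit interval\<close>

definition nabla1 :: "(nat \<Rightarrow> real) \<Rightarrow> nat \<Rightarrow> real" where
  "nabla1 F n = F n - F (Suc n)"

text \<open>The integrand is (1 - x^n)/(1 - x), continued by its limit n at x = 1, so one formula
  covers interior and boundary mass.\<close>

definition moment_sum :: "real measure \<Rightarrow> nat \<Rightarrow> real" where
  "moment_sum M n = (\<integral>x. (\<Sum>k<n. x ^ k) \<partial>M)"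

text \<open>The measure lives on the whole line and is only almost surely in the interval, since
  this is what \<open>distr\<close> into \<open>borel\<close> yields.\<close>

locale unit_interval_measure = finite_measure M for M :: "real measure" +
  assumes sets_M [simp, measurable_cong]: "sets M = sets borel"
    and AE_M: "AE x in M. x \<in> {0..1}"
begin

lemma integrable_unit_interval:
  fixes f :: "real \<Rightarrow> real"
  assumes "f \<in> borel_measurable borel" "\<And>x. x \<in> {0..1} \<Longrightarrow> \<bar>f x\<bar> \<le> B"
  shows "integrable M f"
proof (rule integrable_const_bound)
  show "AE x in M. norm (f x) \<le> B"
    using AE_M by eventually_elim (use assms(2) in simp)
qed (use assms(1) in measurable)

lemma geometric_sum_bounds:
  fixes x :: real
  assumes "x \<in> {0..1}"
  shows "0 \<le> (\<Sum>k<n. x ^ k)" "(\<Sum>k<n. x ^ k) \<le> real n"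
proof -
  show "0 \<le> (\<Sum>k<n. x ^ k)" using assms by (intro sum_nonneg) simp
  show "(\<Sum>k<n. x ^ k) \<le> real n"
    using sum_bounded_above[of "{..<n}" "\<lambda>k. x ^ k" 1] assms by (simp add: power_le_one)
qed

lemma integrable_geometric_sum: "integrable M (\<lambda>x. \<Sum>k<n. x ^ k)"
  by (rule integrable_unit_interval[where B = "real n"]) (use geometric_sum_bounds in auto)

lemma integrable_power: "integrable M (\<lambda>x. x ^ k * (1 - x) ^ j)"
  by (rule integrable_unit_interval[where B = 1])
     (auto simp: abs_mult power_le_one intro!: mult_le_one)

lemma moment_sum_0 [simp]: "moment_sum M 0 = 0"
  by (simp add: moment_sum_def)

lemma moment_sum_Suc: "moment_sum M (Suc n) = moment_sum M n + (\<integral>x. x ^ n \<partial>M)"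
  using integrable_power[of n 0]
  by (simp add: moment_sum_def Bochner_Integration.integral_add[OF integrable_geometric_sum])

text \<open>The first difference removes \<open>c\<close> and leaves minus the n-th moment; every
  further difference inserts a factor 1 - x under the integral, as in the Hausdorff moment
  problem.\<close>

lemma nabla1_moment_sum: "(nabla1 ^^ Suc j) (\<lambda>n. c + moment_sum M n) n \<le> 0"
proof -
  have "(nabla1 ^^ Suc j) (\<lambda>n. c + moment_sum M n) = (\<lambda>n. - (\<integral>x. x ^ n * (1 - x) ^ j \<partial>M))"
  proof (induction j)
    case 0
    show ?case by (simp add: nabla1_def moment_sum_Suc)
  next
    case (Suc j)
    have "(\<integral>x. x ^ n * (1 - x) ^ Suc j \<partial>M) =
        (\<integral>x. x ^ n * (1 - x) ^ j \<partial>M) - (\<integral>x. x ^ Suc n * (1 - x) ^ j \<partial>M)" for n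
      by (subst Bochner_Integration.integral_diff[OF integrable_power integrable_power, symmetric])
         (simp add: algebra_simps)
    then show ?case
      by (subst funpow.simps(2)) (simp only: o_apply Suc, simp add: nabla1_def fun_eq_iff)
  qed
  moreover have "0 \<le> (\<integral>x. x ^ n * (1 - x) ^ j \<partial>M)"
  proof (rule integral_nonneg_AE)
    show "AE x in M. 0 \<le> x ^ n * (1 - x) ^ j" using AE_M by eventually_elim simp
  qed
  ultimately show ?thesis by simp
qed

lemma moment_sum_nonneg: "0 \<le> moment_sum M n"
  unfolding moment_sum_def using AE_M
  by (intro integral_nonneg_AE) (auto elim!: eventually_mono intro!: sum_nonneg)

text \<open>At x = 1 the geometric sum equals n, so leaving out that point costs n times its
  mass.\<close>

lemma integral_geometric_sum_Ico:
  "(\<integral>x. (\<Sum>k<n. x ^ k) * indicator {0..<1} x \<partial>M) = moment_sum M n - real n * measure M {1}"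
proof -
  have "(\<integral>x. (\<Sum>k<n. x ^ k) * indicator {0..<1} x \<partial>M) =
      (\<integral>x. (\<Sum>k<n. x ^ k) - real n * indicator {1} x \<partial>M)"
  proof (rule integral_cong_AE)
    show "AE x in M. (\<Sum>k<n. x ^ k) * indicator {0..<1} x = (\<Sum>k<n. x ^ k) - real n * indicator {1} x"
      using AE_M by eventually_elim (auto split: split_indicator)
  qed measurable
  also have "\<dots> = moment_sum M n - real n * measure M {1}"
    unfolding moment_sum_def
    by (subst Bochner_Integration.integral_diff[OF integrable_geometric_sum])
       (auto intro!: integrable_unit_interval[where B = "real n"] split: split_indicator)
  finally show ?thesis .
qed

text \<open>This is the contribution of one edge to the Levy integral. The companion inequality
  guarantees that \<open>ennreal\<close> does not truncate the right-hand side.\<close>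

lemma nn_integral_geometric_sum_Ico:
  "(\<integral>\<^sup>+x. ennreal (1 / (1 - x)) * ennreal (1 - x ^ n) * indicator {0..<1} x \<partial>M) =
    ennreal (moment_sum M n - real n * measure M {1})"
  and moment_sum_ge: "real n * measure M {1} \<le> moment_sum M n"
proof -
  have "ennreal (1 / (1 - x)) * ennreal (1 - x ^ n) * indicator {0..<1} x =
      ennreal ((\<Sum>k<n. x ^ k) * indicator {0..<1} x)" for x
    by (cases "x \<in> {0..<1}")
       (auto simp: ennreal_mult'[symmetric] one_diff_power_eq)
  then have "(\<integral>\<^sup>+x. ennreal (1 / (1 - x)) * ennreal (1 - x ^ n) * indicator {0..<1} x \<partial>M) =
      (\<integral>\<^sup>+x. ennreal ((\<Sum>k<n. x ^ k) * indicator {0..<1} x) \<partial>M)"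
    by simp
  also have "\<dots> = ennreal (\<integral>x. (\<Sum>k<n. x ^ k) * indicator {0..<1} x \<partial>M)"
  proof (rule nn_integral_eq_integral)
    show "integrable M (\<lambda>x. (\<Sum>k<n. x ^ k) * indicator {0..<1} x)"
      using geometric_sum_bounds
      by (intro integrable_unit_interval[where B = "real n"]) (auto split: split_indicator)
  qed (auto intro!: sum_nonneg split: split_indicator)
  finally show "(\<integral>\<^sup>+x. ennreal (1 / (1 - x)) * ennreal (1 - x ^ n) * indicator {0..<1} x \<partial>M) =
      ennreal (moment_sum M n - real n * measure M {1})"
    by (simp add: integral_geometric_sum_Ico)
  have "0 \<le> (\<integral>x. (\<Sum>k<n. x ^ k) * indicator {0..<1} x \<partial>M)"
    by (intro integral_nonneg_AE AE_I2) (auto intro!: sum_nonneg split: split_indicator)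
  then show "real n * measure M {1} \<le> moment_sum M n"
    by (simp add: integral_geometric_sum_Ico)
qed

text \<open>For x < 1 the geometric sums stay bounded, so their averages tend to 0; at x = 1 the
  averages are 1. Dominated convergence with bound 1 leaves the mass at 1.\<close>

lemma moment_sum_over_n: "(\<lambda>n. moment_sum M n / real n) \<longlonglongrightarrow> measure M {1}"
proof -
  have "(\<lambda>n. \<integral>x. (\<Sum>k<n. x ^ k) / real n \<partial>M) \<longlonglongrightarrow> (\<integral>x. indicator {1} x \<partial>M)"
  proof (rule integral_dominated_convergence[where w = "\<lambda>_. 1"])
    show "AE x in M. (\<lambda>n. (\<Sum>k<n. x ^ k) / real n) \<longlonglongrightarrow> indicator {1} x"
      using AE_M
    proof eventually_elim
      case (elim x)
      show ?case
      proof (cases "x = 1")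
        case True
        have "\<forall>\<^sub>F n in sequentially. (\<Sum>k<n. x ^ k) / real n = indicator {1} x"
          using eventually_gt_at_top[of 0] by eventually_elim (simp add: True)
        then show ?thesis by (rule tendsto_eventually)
      next
        case False
        then have "(\<lambda>n. \<Sum>k<n. x ^ k) \<longlonglongrightarrow> 1 / (1 - x)"
          using geometric_sums[of x] elim by (simp add: sums_def)
        from tendsto_mult[OF this lim_inverse_n] False show ?thesis
          by (simp add: divide_inverse)
      qed
    qed
    show "AE x in M. norm ((\<Sum>k<n. x ^ k) / real n) \<le> 1" for n
      using AE_M
    proof eventually_elim
      case (elim x)
      then show ?case using geometric_sum_bounds[of x n] by (cases "n = 0") auto
    qed
  qed auto
  then show ?thesis by (simp add: moment_sum_def)
qed

text \<open>For a > 0 this is the previous limit along the subsequence \<open>n * a\<close>; it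
  supplies the slope \<open>b\<close> in the Levy representation.\<close>

lemma moment_sum_linear_limit: "(\<lambda>n. moment_sum M (n * a) / real n) \<longlonglongrightarrow> real a * measure M {1}"
proof (cases "a = 0")
  case False
  then have "filterlim (\<lambda>n. n * a) at_top at_top"
    by (intro filterlim_at_top_mono[OF filterlim_ident] eventuallyI) simp_all
  from tendsto_mult_left[OF filterlim_compose[OF moment_sum_over_n this], of "real a"] False
  show ?thesis by simp
qed simp

end

text \<open>Finite Borel measures on a Polish space are inner regular. An exhaustion by sets of
  finite measure transfers this to \<open>L\<close>, and finiteness on compact sets holds because
  each lies in some \<open>A n\<close>.\<close>

lemma radon_measure_onI:
  fixes L :: "'a::{polish_space} measure"
  assumes X: "X \<in> sets borel" and sets: "sets L = sets (restrict_space borel X)"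
    and A: "incseq A" "(\<Union>n. A n) = X" "\<And>n. A n \<in> sets borel" "\<And>n. emeasure L (A n) < \<infinity>"
    and K: "\<And>K. compact K \<Longrightarrow> K \<subseteq> X \<Longrightarrow> \<exists>n::nat. K \<subseteq> A n"
  shows "radon_measure_on X L"
  unfolding radon_measure_on_def
proof (intro conjI ballI allI impI)
  have sets_iff: "B \<in> sets L \<longleftrightarrow> B \<in> sets borel \<and> B \<subseteq> X" for B
    unfolding sets using X by (subst sets_restrict_space_iff) auto
  have A_sets: "A n \<in> sets L" for n using A(2,3) by (auto simp: sets_iff)
  show "sets L = sets (restrict_space borel X)" by (fact sets)
  show "emeasure L K < \<infinity>" if "compact K \<and> K \<subseteq> X" for K
  proof -
    from assms(7)[of K] that obtain n where "K \<subseteq> A n" by auto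
    then have "emeasure L K \<le> emeasure L (A n)" by (rule emeasure_mono) (rule A_sets)
    also have "\<dots> < \<infinity>" by (rule A(4))
    finally show ?thesis .
  qed
  fix B assume B: "B \<in> sets L"
  have K_sets: "K \<in> sets L" if "compact K" "K \<subseteq> B" for K
    using that B by (auto simp: sets_iff intro: borel_compact)
  show "emeasure L B = (SUP K\<in>{K. compact K \<and> K \<subseteq> B}. emeasure L K)"
  proof (rule antisym)
    show "(SUP K\<in>{K. compact K \<and> K \<subseteq> B}. emeasure L K) \<le> emeasure L B"
      using B by (auto intro!: SUP_least emeasure_mono)
    have "emeasure L (B \<inter> A n) \<le> (SUP K\<in>{K. compact K \<and> K \<subseteq> B}. emeasure L K)" for n
    proof -
      \<comment> \<open>The part of \<open>L\<close> on \<open>A n\<close>, moved to the Borel sets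
        of the whole space: a finite measure to which \<open>inner_regular\<close> applies, and one
        dominated by \<open>L\<close>.\<close>
      define L' where "L' = distr (density L (indicator (A n))) borel (\<lambda>x. x)"
      have id [measurable]: "(\<lambda>x. x) \<in> L \<rightarrow>\<^sub>M borel"
        unfolding measurable_cong_sets[OF sets refl] by (rule measurable_restrict_space1) simp
      have space: "space L = X"
        using sets_eq_imp_space_eq[OF sets] by (simp add: space_restrict_space)
      have L': "emeasure L' C = emeasure L (C \<inter> A n)" if "C \<in> sets borel" for C
      proof -
        have "emeasure L' C = emeasure (density L (indicator (A n))) (C \<inter> X)"
          unfolding L'_def using that by (subst emeasure_distr) (simp_all add: space)
        also have "\<dots> = emeasure L (A n \<inter> (C \<inter> X))"
        proof -
          have "C \<inter> X \<in> sets L" using that X by (simp add: sets_iff)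
          then show ?thesis
            using A_sets[of n]
            by (subst emeasure_density) (simp_all add: indicator_inter_arith[symmetric])
        qed
        also have "A n \<inter> (C \<inter> X) = C \<inter> A n" using A(2) by auto
        finally show ?thesis .
      qed
      have "emeasure L' (space L') \<noteq> \<infinity>"
        using L'[of UNIV] A(4)[of n] by (simp add: L'_def)
      moreover have "B \<in> sets borel" using B by (simp add: sets_iff)
      ultimately have "emeasure L' B = (SUP K\<in>{K. K \<subseteq> B \<and> compact K}. emeasure L' K)"
        by (intro inner_regular) (simp_all add: L'_def)
      also have "\<dots> \<le> (SUP K\<in>{K. compact K \<and> K \<subseteq> B}. emeasure L K)"
      proof (rule SUP_mono)
        fix K assume K: "K \<in> {K. K \<subseteq> B \<and> compact K}"
        then have "emeasure L' K \<le> emeasure L K"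
          using K_sets[of K] by (subst L') (auto intro: borel_compact emeasure_mono)
        with K show "\<exists>K'\<in>{K. compact K \<and> K \<subseteq> B}. emeasure L' K \<le> emeasure L K'" by auto
      qed
      finally show ?thesis using L'[OF \<open>B \<in> sets borel\<close>] by simp
    qed
    moreover have "emeasure L B = (SUP n. emeasure L (B \<inter> A n))"
    proof -
      have "(\<Union>n. B \<inter> A n) = B" using B A(2) by (auto simp: sets_iff)
      then show ?thesis
        using SUP_emeasure_incseq[of "\<lambda>n. B \<inter> A n" L] B A_sets A(1)
        by (force simp: incseq_def)
    qed
    ultimately show "emeasure L B \<le> (SUP K\<in>{K. compact K \<and> K \<subseteq> B}. emeasure L K)"
      by (simp add: SUP_le_iff)
  qed
qed

section \<open>The edge measure as a Levy measure\<close>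

locale edge_measures =
  M: unit_interval_measure M + N: unit_interval_measure N for M N :: "real measure"
begin

lemma sets_edge_measure: "sets (edge_measure M N) = sets (restrict_space borel punctured_square)"
proof -
  have "sets (M \<Otimes>\<^sub>M return borel 1) = sets (borel \<Otimes>\<^sub>M borel)"
    by (intro sets_pair_measure_cong) simp_all
  then show ?thesis
    by (simp add: edge_measure_def sets_restrict_space)
qed

text \<open>Tonelli integrates out the Dirac factors. Each edge meets the punctured square in a copy
  of [0,1), whence the two indicators.\<close>

lemma nn_integral_edge_measure:
  assumes f: "f \<in> borel_measurable borel"
  shows "(\<integral>\<^sup>+x. f x \<partial>edge_measure M N) =
    (\<integral>\<^sup>+x. ennreal (1 / (1 - x)) * f (x, 1) * indicator {0..<1} x \<partial>M) +
    (\<integral>\<^sup>+y. ennreal (1 / (1 - y)) * f (1, y) * indicator {0..<1} y \<partial>N)"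
proof -
  have f' [measurable]: "f \<in> borel_measurable (borel \<Otimes>\<^sub>M borel)"
    using f by (simp cong: measurable_cong_sets)
  have ps [measurable]: "punctured_square \<in> sets (borel \<Otimes>\<^sub>M borel)"
    by simp
  have sets1: "sets (M \<Otimes>\<^sub>M return borel (1::real)) = sets (borel \<Otimes>\<^sub>M borel)"
    and sets2: "sets (return borel (1::real) \<Otimes>\<^sub>M N) = sets (borel \<Otimes>\<^sub>M borel)"
    by (intro sets_pair_measure_cong; simp)+
  let ?R1 = "restrict_space (M \<Otimes>\<^sub>M return borel 1) punctured_square"
  let ?R2 = "restrict_space (return borel 1 \<Otimes>\<^sub>M N) punctured_square"
  have fR: "f \<in> borel_measurable ?R1" "f \<in> borel_measurable ?R2"
    by (intro measurable_restrict_space1;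
        simp add: measurable_cong_sets[OF sets1 refl] measurable_cong_sets[OF sets2 refl])+
  have dR: "(\<lambda>x. ennreal (1 / (1 - fst x))) \<in> borel_measurable ?R1"
      "(\<lambda>x. ennreal (1 / (1 - snd x))) \<in> borel_measurable ?R2"
    by (intro measurable_restrict_space1;
        simp add: measurable_cong_sets[OF sets1 refl] measurable_cong_sets[OF sets2 refl])+
  have "(\<integral>\<^sup>+x. f x \<partial>edge_measure M N) =
      (\<integral>\<^sup>+x. ennreal (1 / (1 - fst x)) * f x \<partial>?R1) + (\<integral>\<^sup>+x. ennreal (1 / (1 - snd x)) * f x \<partial>?R2)"
    unfolding edge_measure_def using fR dR
    by (subst nn_integral_add_measure) (simp_all add: nn_integral_density sets_restrict_space sets1 sets2)
  also have "(\<integral>\<^sup>+x. ennreal (1 / (1 - fst x)) * f x \<partial>?R1) =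
      (\<integral>\<^sup>+x. ennreal (1 / (1 - fst x)) * f x * indicator punctured_square x \<partial>(M \<Otimes>\<^sub>M return borel 1))"
    by (rule nn_integral_restrict_space) (simp add: sets1)
  also have "\<dots> = (\<integral>\<^sup>+x. ennreal (1 / (1 - x)) * f (x, 1) * indicator {0..<1} x \<partial>M)"
    by (subst nn_integral_pair_return_right[OF M.sigma_finite_measure_axioms], measurable)
       (auto simp: punctured_square_def split: split_indicator intro!: nn_integral_cong)
  also have "(\<integral>\<^sup>+x. ennreal (1 / (1 - snd x)) * f x \<partial>?R2) =
      (\<integral>\<^sup>+x. ennreal (1 / (1 - snd x)) * f x * indicator punctured_square x \<partial>(return borel 1 \<Otimes>\<^sub>M N))"
    by (rule nn_integral_restrict_space) (simp add: sets2)
  also have "\<dots> = (\<integral>\<^sup>+y. ennreal (1 / (1 - y)) * f (1, y) * indicator {0..<1} y \<partial>N)"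
    by (subst nn_integral_pair_return_left[OF N.sigma_finite_measure_axioms], measurable)
       (auto simp: punctured_square_def split: split_indicator intro!: nn_integral_cong)
  finally show ?thesis .
qed

text \<open>The function is a sum of functions of one variable each. A partial difference kills the
  summand in the other variable, so mixed differences vanish and pure ones are
  one-dimensional.\<close>

lemma completely_alternating_moment_sums:
  "completely_alternating (\<lambda>\<alpha>. 1 + moment_sum M (fst \<alpha>) + moment_sum N (snd \<alpha>))"
proof -
  define split :: "(nat \<Rightarrow> real) \<Rightarrow> (nat \<Rightarrow> real) \<Rightarrow> nat \<times> nat \<Rightarrow> real" where
    "split F G = (\<lambda>\<alpha>. F (fst \<alpha>) + G (snd \<alpha>))" for F G
  have nabla1: "nabla (1, 0) (split F G) = split (nabla1 F) (\<lambda>_. 0)"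
    and nabla2: "nabla (0, 1) (split F G) = split (\<lambda>_. 0) (nabla1 G)" for F G
    by (simp_all add: fun_eq_iff nabla_def split_def nabla1_def)
  have pow2: "(nabla (0, 1) ^^ j) (split F G) = split (if j = 0 then F else (\<lambda>_. 0)) ((nabla1 ^^ j) G)"
    for j F G
    by (induction j) (simp_all only: funpow.simps o_apply id_apply nabla2 if_True if_False refl nat.simps)
  have pow1: "(nabla (1, 0) ^^ i) (split F G) = split ((nabla1 ^^ i) F) (if i = 0 then G else (\<lambda>_. 0))"
    for i F G
    by (induction i) (simp_all only: funpow.simps o_apply id_apply nabla1 if_True if_False refl nat.simps)
  have zero: "(nabla1 ^^ i) (\<lambda>_. 0) = (\<lambda>_. 0)" for i
    by (induction i) (simp_all add: nabla1_def)
  \<comment> \<open>The constant 1 goes to the first summand; the \<open>0 +\<close> in the second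
    gives it the shape \<open>c + moment_sum\<close> required by
    \<open>nabla1_moment_sum\<close>.\<close>
  have "nabla_pow \<alpha> (split (\<lambda>n. 1 + moment_sum M n) (\<lambda>n. 0 + moment_sum N n)) \<beta> \<le> 0"
    if "\<alpha> \<noteq> 0" for \<alpha> \<beta>
  proof (cases "fst \<alpha>")
    case 0
    with that have "snd \<alpha> \<noteq> 0" by (auto simp: prod_eq_iff)
    then obtain j where "snd \<alpha> = Suc j" by (cases "snd \<alpha>") auto
    with 0 show ?thesis
      unfolding nabla_pow_def pow2 pow1 using N.nabla1_moment_sum[of j 0 "snd \<beta>"]
      by (simp add: split_def del: funpow.simps)
  next
    case (Suc i)
    then show ?thesis
      unfolding nabla_pow_def pow2 pow1 using M.nabla1_moment_sum[of i 1 "fst \<beta>"]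
      by (simp add: split_def zero del: funpow.simps)
  qed
  then show ?thesis
    by (simp add: completely_alternating_def split_def add.assoc)
qed

text \<open>The exhausting sets stay away from (1,1): on either edge the free coordinate is at most
  1 - 1/(n+1), so the density is at most n+1. A nonempty compact subset lies in one of them because
  the coordinate sum attains a maximum below 2.\<close>

lemma radon_edge_measure: "radon_measure_on punctured_square (edge_measure M N)"
proof (rule radon_measure_onI[OF _ sets_edge_measure])
  define A :: "nat \<Rightarrow> (real \<times> real) set" where
    "A n = {x \<in> punctured_square. fst x + snd x \<le> 2 - 1 / real (Suc n)}" for n
  have less_2: "fst x + snd x < 2" if "x \<in> punctured_square" for x
    using that by (auto simp: punctured_square_def)
  have ex: "\<exists>n. s \<le> 2 - 1 / real (Suc n)" if "s < 2" for s :: real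
  proof -
    from that obtain n where "inverse (real (Suc n)) < 2 - s"
      using reals_Archimedean[of "2 - s"] by auto
    then have "s \<le> 2 - 1 / real (Suc n)" by (simp add: inverse_eq_divide)
    then show ?thesis ..
  qed
  show "punctured_square \<in> sets borel" by simp
  show "incseq A"
  proof (rule incseq_SucI)
    fix n
    have "1 / real (Suc (Suc n)) \<le> 1 / real (Suc n)" by (simp add: frac_le)
    then show "A n \<subseteq> A (Suc n)" unfolding A_def by auto
  qed
  show "(\<Union>n. A n) = punctured_square"
    using less_2 ex by (fastforce simp: A_def)
  show A_borel: "A n \<in> sets borel" for n
  proof -
    have "A n = punctured_square \<inter> {x. fst x + snd x \<le> 2 - 1 / real (Suc n)}"
      by (auto simp: A_def)
    also have "\<dots> \<in> sets borel"
      by (intro sets.Int borel_punctured_square borel_closed closed_Collect_le continuous_intros)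
    finally show ?thesis .
  qed
  show "emeasure (edge_measure M N) (A n) < \<infinity>" for n
  proof -
    \<comment> \<open>Here \<open>i\<close> is the value of the indicator on either of the two
      edges, so that a single estimate serves both integrals.\<close>
    have bound: "ennreal (1 / (1 - x)) * i * indicator {0..<1} x \<le> ennreal (real (Suc n))"
      if "i = indicator (A n) (x, 1) \<or> i = indicator (A n) (1, x)" for x i
    proof (cases "i = 0 \<or> x \<notin> {0..<1}")
      case False
      then have "1 / real (Suc n) \<le> 1 - x" "i = 1"
        using that by (auto simp: A_def indicator_def split: if_splits)
      then have "1 / (1 - x) \<le> real (Suc n)"
        using False by (simp add: field_simps)
      then have "ennreal (1 / (1 - x)) \<le> ennreal (real (Suc n))" by (rule ennreal_leI)
      then show ?thesis using False \<open>i = 1\<close> by (simp del: of_nat_Suc)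
    qed auto
    have An: "A n \<in> sets (edge_measure M N)"
      unfolding sets_edge_measure using A_borel[of n]
      by (subst sets_restrict_space_iff) (auto simp: A_def)
    have "emeasure (edge_measure M N) (A n) = (\<integral>\<^sup>+x. indicator (A n) x \<partial>edge_measure M N)"
      using An by simp
    also have "\<dots> = (\<integral>\<^sup>+x. ennreal (1 / (1 - x)) * indicator (A n) (x, 1) * indicator {0..<1} x \<partial>M) +
        (\<integral>\<^sup>+x. ennreal (1 / (1 - x)) * indicator (A n) (1, x) * indicator {0..<1} x \<partial>N)"
      using A_borel[of n] by (intro nn_integral_edge_measure) simp
    also have "\<dots> \<le> (\<integral>\<^sup>+x. ennreal (real (Suc n)) \<partial>M) + (\<integral>\<^sup>+x. ennreal (real (Suc n)) \<partial>N)"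
      by (intro add_mono nn_integral_mono bound) simp_all
    also have "\<dots> < \<infinity>"
      by (simp add: ennreal_mult_less_top M.emeasure_eq_measure N.emeasure_eq_measure)
    finally show ?thesis .
  qed
  show "\<exists>n. K \<subseteq> A n" if "compact K" "K \<subseteq> punctured_square" for K
  proof (cases "K = {}")
    case False
    have "continuous_on K (\<lambda>x. fst x + snd x)" by (intro continuous_intros)
    then obtain x0 where x0: "x0 \<in> K" "\<forall>x\<in>K. fst x + snd x \<le> fst x0 + snd x0"
      using continuous_attains_sup[OF \<open>compact K\<close> False] by blast
    with that obtain n where "fst x0 + snd x0 \<le> 2 - 1 / real (Suc n)"
      using ex less_2 by blast
    with x0 that have "K \<subseteq> A n" by (force simp: A_def)
    then show ?thesis ..
  qed simp
qed

text \<open>On an edge the monomial reduces to a power of the free coordinate. The integrand is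
  nonnegative, so one finite \<open>ennreal\<close> value gives integrability and the integral
  together.\<close>

lemma
  shows integrable_edge_measure: "integrable (edge_measure M N) (\<lambda>x. 1 - monomial \<alpha> x)"
    and integral_edge_measure: "(\<integral>x. 1 - monomial \<alpha> x \<partial>edge_measure M N) =
      (moment_sum M (fst \<alpha>) - real (fst \<alpha>) * measure M {1}) +
      (moment_sum N (snd \<alpha>) - real (snd \<alpha>) * measure N {1})"
proof -
  have space: "space (edge_measure M N) = punctured_square"
    using sets_eq_imp_space_eq[OF sets_edge_measure] by (simp add: space_restrict_space)
  have nonneg: "AE x in edge_measure M N. 0 \<le> 1 - monomial \<alpha> x"
    by (intro AE_I2) (use monomial_le_1(2) in \<open>auto simp: space punctured_square_def\<close>)
  have meas: "(\<lambda>x. 1 - monomial \<alpha> x) \<in> borel_measurable (edge_measure M N)"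
    unfolding measurable_cong_sets[OF sets_edge_measure refl]
    by (rule measurable_restrict_space1) measurable
  have eq: "(\<integral>\<^sup>+x. ennreal (1 - monomial \<alpha> x) \<partial>edge_measure M N) =
      ennreal ((moment_sum M (fst \<alpha>) - real (fst \<alpha>) * measure M {1}) +
        (moment_sum N (snd \<alpha>) - real (snd \<alpha>) * measure N {1}))"
    using M.moment_sum_ge N.moment_sum_ge
    by (subst nn_integral_edge_measure, measurable)
       (simp_all add: monomial_def M.nn_integral_geometric_sum_Ico N.nn_integral_geometric_sum_Ico
         ennreal_plus)
  show "integrable (edge_measure M N) (\<lambda>x. 1 - monomial \<alpha> x)"
    using integrableI_nn_integral_finite[OF meas nonneg eq] .
  show "(\<integral>x. 1 - monomial \<alpha> x \<partial>edge_measure M N) =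
      (moment_sum M (fst \<alpha>) - real (fst \<alpha>) * measure M {1}) +
      (moment_sum N (snd \<alpha>) - real (snd \<alpha>) * measure N {1})"
    unfolding integral_eq_nn_integral[OF meas nonneg] eq
    using M.moment_sum_ge N.moment_sum_ge by (intro enn2real_ennreal add_nonneg_nonneg) simp_all
qed

lemma levy_measure_edge_measure:
  "levy_measure_of (\<lambda>\<alpha>. 1 + moment_sum M (fst \<alpha>) + moment_sum N (snd \<alpha>)) (edge_measure M N)"
  (is "levy_measure_of ?\<phi> _")
proof -
  define b :: "nat \<times> nat \<Rightarrow> real" where
    "b \<alpha> = real (fst \<alpha>) * measure M {1} + real (snd \<alpha>) * measure N {1}" for \<alpha>
  have "(\<lambda>n. ?\<phi> (n * fst \<alpha>, n * snd \<alpha>) / real n) \<longlonglongrightarrow> b \<alpha>" for \<alpha>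
  proof -
    have "(\<lambda>n. 1 / real n + moment_sum M (n * fst \<alpha>) / real n + moment_sum N (n * snd \<alpha>) / real n)
        \<longlonglongrightarrow> 0 + real (fst \<alpha>) * measure M {1} + real (snd \<alpha>) * measure N {1}"
      by (intro tendsto_add lim_1_over_n M.moment_sum_linear_limit N.moment_sum_linear_limit)
    then show ?thesis by (simp add: b_def add_divide_distrib)
  qed
  moreover have "?\<phi> 0 = 1" "\<And>\<alpha>. 0 \<le> b \<alpha>" "\<And>\<alpha> \<beta>. b (\<alpha> + \<beta>) = b \<alpha> + b \<beta>"
    by (simp_all add: b_def algebra_simps)
  moreover have "?\<phi> \<alpha> = 1 + b \<alpha> + (\<integral>x. 1 - monomial \<alpha> x \<partial>edge_measure M N)" for \<alpha>
    by (simp add: integral_edge_measure b_def)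
  ultimately show ?thesis
    unfolding levy_measure_of_def
    using radon_edge_measure integrable_edge_measure completely_alternating_moment_sums
    by (intro conjI exI[of _ 1] exI[of _ b]) simp_all
qed

theorem levy_measure_of_moment_sums_iff:
  "levy_measure_of (\<lambda>\<alpha>. 1 + moment_sum M (fst \<alpha>) + moment_sum N (snd \<alpha>)) \<nu> \<longleftrightarrow>
    \<nu> = edge_measure M N"
  using levy_measure_edge_measure levy_measure_unique by blast

end

section \<open>Area integrals and circle means\<close>

lemma borel_measurable_Complex [measurable]:
  assumes [measurable]: "f \<in> borel_measurable M" "g \<in> borel_measurable M"
  shows "(\<lambda>x. Complex (f x) (g x)) \<in> borel_measurable M"
  unfolding Complex_eq by measurable

text \<open>Lebesgue measure is determined by its values on boxes, and a complex box is a rectangle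
  in the real and imaginary parts.\<close>

lemma lborel_complex_eq:
  "(lborel :: complex measure) = distr (lborel \<Otimes>\<^sub>M lborel) borel (\<lambda>x. Complex (fst x) (snd x))"
proof (rule lborel_eqI)
  fix l u :: complex
  assume le: "\<And>b. b \<in> Basis \<Longrightarrow> l \<bullet> b \<le> u \<bullet> b"
  have le': "Re l \<le> Re u" "Im l \<le> Im u"
    using le[of 1] le[of \<i>] by (simp_all add: Basis_complex_def)
  have "emeasure (distr (lborel \<Otimes>\<^sub>M lborel) borel (\<lambda>x. Complex (fst x) (snd x))) (box l u) =
      emeasure (lborel \<Otimes>\<^sub>M lborel) ({Re l<..<Re u} \<times> {Im l<..<Im u})"
    by (subst emeasure_distr)
       (auto intro!: arg_cong[where f = "emeasure _"] simp: box_def Basis_complex_def space_pair_measure)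
  also have "\<dots> = ennreal (Re u - Re l) * ennreal (Im u - Im l)"
    using le' by (subst lborel.emeasure_pair_measure_Times) simp_all
  finally show "emeasure (distr (lborel \<Otimes>\<^sub>M lborel) borel (\<lambda>x. Complex (fst x) (snd x))) (box l u) =
      ennreal (\<Prod>b\<in>Basis. (u - l) \<bullet> b)"
    using le' by (simp add: Basis_complex_def ennreal_mult')
qed simp

text \<open>Both orders of integration are recorded, one for each direction of shear.\<close>

lemma
  fixes f :: "complex \<Rightarrow> ennreal"
  assumes [measurable]: "f \<in> borel_measurable borel"
  shows nn_integral_complex_Re_inner:
      "(\<integral>\<^sup>+z. f z \<partial>lborel) = (\<integral>\<^sup>+y. \<integral>\<^sup>+x. f (Complex x y) \<partial>lborel \<partial>lborel)"
    and nn_integral_complex_Im_inner: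
      "(\<integral>\<^sup>+z. f z \<partial>lborel) = (\<integral>\<^sup>+x. \<integral>\<^sup>+y. f (Complex x y) \<partial>lborel \<partial>lborel)"
proof -
  have *: "(\<integral>\<^sup>+z. f z \<partial>lborel) = (\<integral>\<^sup>+x. f (Complex (fst x) (snd x)) \<partial>(lborel \<Otimes>\<^sub>M lborel))"
    by (subst lborel_complex_eq) (simp add: nn_integral_distr)
  also have "\<dots> = (\<integral>\<^sup>+x. \<integral>\<^sup>+y. f (Complex x y) \<partial>lborel \<partial>lborel)"
    by (subst lborel.nn_integral_fst[symmetric]) simp_all
  finally show "(\<integral>\<^sup>+z. f z \<partial>lborel) = (\<integral>\<^sup>+x. \<integral>\<^sup>+y. f (Complex x y) \<partial>lborel \<partial>lborel)" .
  note *
  also have "(\<integral>\<^sup>+x. f (Complex (fst x) (snd x)) \<partial>(lborel \<Otimes>\<^sub>M lborel)) =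
      (\<integral>\<^sup>+y. \<integral>\<^sup>+x. f (Complex x y) \<partial>lborel \<partial>lborel)"
    by (subst lborel_pair.nn_integral_snd[symmetric]) (simp_all add: case_prod_beta')
  finally show "(\<integral>\<^sup>+z. f z \<partial>lborel) = (\<integral>\<^sup>+y. \<integral>\<^sup>+x. f (Complex x y) \<partial>lborel \<partial>lborel)" .
qed

text \<open>On each horizontal line the shear is a translation.\<close>

lemma nn_integral_horizontal_shear:
  fixes f :: "complex \<Rightarrow> ennreal"
  assumes [measurable]: "f \<in> borel_measurable borel"
  shows "(\<integral>\<^sup>+z. f (Complex (Re z + a * Im z) (Im z)) \<partial>lborel) = (\<integral>\<^sup>+z. f z \<partial>lborel)"
proof -
  have "(\<integral>\<^sup>+x. f (Complex (x + a * y) y) \<partial>lborel) = (\<integral>\<^sup>+x. f (Complex x y) \<partial>lborel)" for y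
    using nn_integral_real_affine[of "\<lambda>x. f (Complex x y)" 1 "a * y"] by (simp add: add.commute)
  then show ?thesis by (subst (1 2) nn_integral_complex_Re_inner) simp_all
qed

lemma nn_integral_vertical_shear:
  fixes f :: "complex \<Rightarrow> ennreal"
  assumes [measurable]: "f \<in> borel_measurable borel"
  shows "(\<integral>\<^sup>+z. f (Complex (Re z) (Im z + a * Re z)) \<partial>lborel) = (\<integral>\<^sup>+z. f z \<partial>lborel)"
proof -
  have "(\<integral>\<^sup>+y. f (Complex x (y + a * x)) \<partial>lborel) = (\<integral>\<^sup>+y. f (Complex x y) \<partial>lborel)" for x
    using nn_integral_real_affine[of "\<lambda>y. f (Complex x y)" 1 "a * x"] by (simp add: add.commute)
  then show ?thesis by (subst (1 2) nn_integral_complex_Im_inner) simp_all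
qed

text \<open>A rotation other than \<open>-1\<close> is a product of three shears.\<close>

lemma nn_integral_rotate:
  fixes f :: "complex \<Rightarrow> ennreal"
  assumes f: "f \<in> borel_measurable borel" and c: "norm c = 1"
  shows "(\<integral>\<^sup>+z. f (c * z) \<partial>lborel) = (\<integral>\<^sup>+z. f z \<partial>lborel)"
proof -
  have shears: "(\<integral>\<^sup>+z. f (c * z) \<partial>lborel) = (\<integral>\<^sup>+z. f z \<partial>lborel)"
    if f [measurable]: "f \<in> borel_measurable borel" and c: "norm c = 1" "c \<noteq> -1"
    for f :: "complex \<Rightarrow> ennreal" and c
  proof -
    define p q where "p = Re c" and "q = Im c"
    have pq: "p\<^sup>2 + q\<^sup>2 = 1" using c(1) by (simp add: p_def q_def cmod_def)
    have "1 + p \<noteq> 0"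
    proof
      assume "1 + p = 0"
      then have "p = -1" by simp
      with pq c(2) show False by (auto simp: complex_eq_iff p_def q_def)
    qed
    \<comment> \<open>For c = p + iq of angle t this is -tan(t/2), the horizontal shear in the
      factorization; the relations \<open>qa\<close> and \<open>ap\<close> are all that is needed of
      it.\<close>
    define a where "a = - q / (1 + p)"
    have qa: "a * q = p - 1"
      using pq \<open>1 + p \<noteq> 0\<close> by (simp add: a_def field_simps power2_eq_square)
    have ap: "a * (1 + p) = - q" using \<open>1 + p \<noteq> 0\<close> by (simp add: a_def)
    let ?h = "\<lambda>z. Complex (Re z + a * Im z) (Im z)" and ?v = "\<lambda>z. Complex (Re z) (Im z + q * Re z)"
    have "?h (?v (?h z)) = c * z" for z
    proof -
      have "Im z + q * (Re z + a * Im z) = q * Re z + (1 + a * q) * Im z" by (simp add: algebra_simps)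
      moreover have "Re z + a * Im z + a * (q * Re z + (1 + a * q) * Im z) =
          (1 + a * q) * Re z + a * (1 + (1 + a * q)) * Im z" by (simp add: algebra_simps)
      ultimately show ?thesis
        using qa ap by (simp add: complex_eq_iff p_def q_def)
    qed
    then have "(\<integral>\<^sup>+z. f (c * z) \<partial>lborel) = (\<integral>\<^sup>+z. f (?h (?v (?h z))) \<partial>lborel)" by simp
    also have "\<dots> = (\<integral>\<^sup>+z. f (?h (?v z)) \<partial>lborel)"
      using nn_integral_horizontal_shear[of "\<lambda>w. f (?h (?v w))" a] by simp
    also have "\<dots> = (\<integral>\<^sup>+z. f (?h z) \<partial>lborel)"
      using nn_integral_vertical_shear[of "\<lambda>w. f (?h w)" q] by simp
    also have "\<dots> = (\<integral>\<^sup>+z. f z \<partial>lborel)"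
      by (rule nn_integral_horizontal_shear) simp
    finally show ?thesis .
  qed
  show ?thesis
  proof (cases "c = -1")
    case True
    have [measurable]: "f \<in> borel_measurable borel" by fact
    \<comment> \<open>The half turn is the square of the quarter turn \<open>\<i>\<close>, to which
      the shears apply.\<close>
    have "(\<integral>\<^sup>+z. f (- 1 * z) \<partial>lborel) = (\<integral>\<^sup>+z. f (\<i> * (\<i> * z)) \<partial>lborel)"
      by (simp add: mult.assoc[symmetric])
    also have "\<dots> = (\<integral>\<^sup>+z. f (\<i> * z) \<partial>lborel)"
      by (rule shears[of "\<lambda>z. f (\<i> * z)"]) (auto simp: complex_eq_iff)
    also have "\<dots> = (\<integral>\<^sup>+z. f z \<partial>lborel)"
      by (rule shears) (auto simp: complex_eq_iff f)
    finally show ?thesis by (simp add: True)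
  qed (rule shears[OF f c])
qed

section \<open>Circle averages and radial integrals over the disc\<close>

lemma emeasure_unit_disc: "emeasure lborel (ball (0::complex) 1) = ennreal pi"
  by (simp add: emeasure_ball unit_ball_vol_2)

lemma prob_space_area_measure: "prob_space area_measure"
  by (rule prob_space_uniform_measure) (simp_all add: emeasure_unit_disc)

text \<open>A rotation preserves both Lebesgue measure and the disc, so the integral may be averaged
  over all rotations and the order of integration exchanged.\<close>

lemma nn_integral_area_circle_average:
  fixes f :: "complex \<Rightarrow> ennreal"
  assumes f [measurable]: "f \<in> borel_measurable borel"
  shows "(\<integral>\<^sup>+z. f z \<partial>area_measure) =
    (\<integral>\<^sup>+z. (\<integral>\<^sup>+t. f (cis (2 * pi * t) * z) * indicator {0..1} t \<partial>lborel) \<partial>area_measure)"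
proof -
  have cis [measurable]: "(\<lambda>t::real. cis (2 * pi * t)) \<in> borel_measurable borel"
    by (intro borel_measurable_continuous_onI continuous_intros)
  have rot: "(\<integral>\<^sup>+z. f (c * z) \<partial>area_measure) = (\<integral>\<^sup>+z. f z \<partial>area_measure)" if "norm c = 1" for c
  proof -
    have "(\<integral>\<^sup>+z. f (c * z) * indicator (ball 0 1) z \<partial>lborel) =
        (\<integral>\<^sup>+z. f (c * z) * indicator (ball 0 1) (c * z) \<partial>lborel)"
      using that by (intro nn_integral_cong) (simp add: indicator_def norm_mult)
    also have "\<dots> = (\<integral>\<^sup>+z. f z * indicator (ball 0 1) z \<partial>lborel)"
    proof (rule nn_integral_rotate[of "\<lambda>z. f z * indicator (ball 0 1) z", OF _ that])
      have "ball (0::complex) 1 \<in> sets borel" by simp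
      then show "(\<lambda>z. f z * indicator (ball 0 1) z) \<in> borel_measurable borel"
        using f by measurable
    qed
    finally show ?thesis by (simp add: nn_integral_uniform_measure)
  qed
  interpret A: prob_space area_measure by (rule prob_space_area_measure)
  interpret P: pair_sigma_finite area_measure "lborel :: real measure"
    by (intro pair_sigma_finite.intro A.sigma_finite_measure_axioms sigma_finite_lborel)
  have "(\<integral>\<^sup>+z. (\<integral>\<^sup>+t. f (cis (2 * pi * t) * z) * indicator {0..1} t \<partial>lborel) \<partial>area_measure) =
      (\<integral>\<^sup>+t. (\<integral>\<^sup>+z. f (cis (2 * pi * t) * z) * indicator {0..1} t \<partial>area_measure) \<partial>lborel)"
    by (rule P.Fubini'[symmetric]) (simp add: case_prod_beta')
  also have "\<dots> = (\<integral>\<^sup>+t. (\<integral>\<^sup>+z. f z \<partial>area_measure) * indicator {0..1} t \<partial>(lborel :: real measure))"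
    by (intro nn_integral_cong) (simp add: nn_integral_multc rot)
  also have "\<dots> = (\<integral>\<^sup>+z. f z \<partial>area_measure)"
    by (subst nn_integral_cmult) simp_all
  finally show ?thesis by simp
qed

text \<open>For t in [0,1] the disc |z|^2 <= t has area pi t, so after normalization the
  distribution functions agree.\<close>

lemma distr_area_norm_sq:
  "distr area_measure borel (\<lambda>z. (cmod z)\<^sup>2) = uniform_measure lborel {0..1::real}"
proof (rule cdf_unique)
  interpret A: prob_space area_measure by (rule prob_space_area_measure)
  interpret U: prob_space "uniform_measure lborel {0..1::real}"
    by (rule prob_space_uniform_measure) simp_all
  show "real_distribution (distr area_measure borel (\<lambda>z. (cmod z)\<^sup>2))"
    by (intro A.real_distribution_distr) simp
  show "real_distribution (uniform_measure lborel {0..1::real})"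
    by (intro real_distribution.intro U.prob_space_axioms real_distribution_axioms.intro) simp
  have "emeasure (distr area_measure borel (\<lambda>z. (cmod z)\<^sup>2)) {..t} =
      emeasure (uniform_measure lborel {0..1}) {..t}" for t :: real
  proof -
    have "emeasure (distr area_measure borel (\<lambda>z. (cmod z)\<^sup>2)) {..t} =
        emeasure lborel (ball 0 1 \<inter> {z. (cmod z)\<^sup>2 \<le> t}) / ennreal pi"
      by (subst emeasure_distr) (simp_all add: emeasure_unit_disc vimage_def)
    also have "\<dots> = emeasure lborel ({0..1} \<inter> {..t})"
    proof -
      consider "t < 0" | "0 \<le> t" "t < 1" | "1 \<le> t" by linarith
      then show ?thesis
      proof cases
        case 1
        then have "{z::complex. (cmod z)\<^sup>2 \<le> t} = {}" "{0..1} \<inter> {..t} = {}"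
          by (auto simp: not_le intro: less_le_trans)
        then show ?thesis by simp
      next
        case 2
        have "cmod z < 1" if "(cmod z)\<^sup>2 \<le> t" for z
          using that 2 by (intro power2_less_imp_less[of "cmod z" 1]) auto
        moreover have "(cmod z)\<^sup>2 \<le> t \<longleftrightarrow> cmod z \<le> sqrt t" for z
          using 2 by (metis norm_ge_zero real_sqrt_le_iff real_sqrt_abs abs_norm_cancel)
        ultimately have "ball 0 1 \<inter> {z::complex. (cmod z)\<^sup>2 \<le> t} = cball 0 (sqrt t)"
          by auto
        moreover have "{0..1} \<inter> {..t} = {0..t}" using 2 by auto
        ultimately show ?thesis
          using 2 by (simp add: emeasure_cball unit_ball_vol_2 ennreal_mult' ennreal_mult_divide_eq
              mult.commute[of "ennreal pi"])
      next
        case 3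
        have "(cmod z)\<^sup>2 \<le> t" if "cmod z < 1" for z
          using that 3 power_le_one[OF norm_ge_zero, of z 2] by auto
        then have "ball 0 1 \<inter> {z::complex. (cmod z)\<^sup>2 \<le> t} = ball 0 1" by auto
        moreover have "{0..1} \<inter> {..t} = {0..1}" using 3 by auto
        ultimately show ?thesis by (simp add: emeasure_unit_disc ennreal_divide_self)
      qed
    qed
    also have "\<dots> = emeasure (uniform_measure lborel {0..1}) {..t}"
      by (simp add: divide_ennreal_def)
    finally show ?thesis .
  qed
  then show "cdf (distr area_measure borel (\<lambda>z. (cmod z)\<^sup>2)) = cdf (uniform_measure lborel {0..1})"
    by (simp add: fun_eq_iff cdf_def measure_def)
qed

lemma nn_integral_area_radial:
  fixes h :: "real \<Rightarrow> ennreal"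
  assumes [measurable]: "h \<in> borel_measurable borel"
  shows "(\<integral>\<^sup>+z. h ((cmod z)\<^sup>2) \<partial>area_measure) = (\<integral>\<^sup>+t. h t * indicator {0..1} t \<partial>lborel)"
proof -
  have "(\<integral>\<^sup>+z. h ((cmod z)\<^sup>2) \<partial>area_measure) =
      (\<integral>\<^sup>+t. h t \<partial>distr area_measure borel (\<lambda>z. (cmod z)\<^sup>2))"
    by (simp add: nn_integral_distr)
  also have "\<dots> = (\<integral>\<^sup>+t. h t * indicator {0..1} t \<partial>lborel)"
    unfolding distr_area_norm_sq by (simp add: nn_integral_uniform_measure divide_ennreal_def)
  finally show ?thesis .
qed

text \<open>A single value of |z|^2 has probability 0 under the uniform distribution. This will
  discard the circle |z| = |\<zeta>|, which the mean of the logarithmic kernel does not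
  cover.\<close>

lemma AE_area_norm_neq: "AE z in area_measure. cmod z \<noteq> r"
proof -
  have "(\<integral>\<^sup>+z. indicator {r\<^sup>2} ((cmod z)\<^sup>2) \<partial>area_measure) =
      (\<integral>\<^sup>+t. indicator {r\<^sup>2} t * indicator {0..1} t \<partial>(lborel :: real measure))"
    by (rule nn_integral_area_radial) simp
  also have "\<dots> = (\<integral>\<^sup>+t. indicator ({r\<^sup>2} \<inter> {0..1}) t \<partial>(lborel :: real measure))"
    by (simp add: indicator_inter_arith)
  also have "\<dots> = 0"
    by (simp add: emeasure_lborel_countable)
  finally have "AE z in area_measure. indicator {r\<^sup>2} ((cmod z)\<^sup>2) = (0 :: ennreal)"
    by (subst (asm) nn_integral_0_iff_AE) simp_all
  then show ?thesis by eventually_elim (auto simp: indicator_def split: if_splits)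
qed

section \<open>Circle means of the logarithmic and Poisson kernels\<close>

lemma has_integral_circle_mean:
  assumes "g holomorphic_on cball 0 1"
  shows "((\<lambda>t. g (cis (2 * pi * t))) has_integral g 0) {0..1}"
proof -
  have eq: "circlepath 0 1 t = cis (2 * pi * t)" for t
    by (simp add: circlepath cis_conv_exp mult_ac)
  \<comment> \<open>Cauchy's formula at the centre: on the unit circle the derivative of the path
    cancels the denominator up to the constant 2 pi i.\<close>
  have "((\<lambda>u. g u / (u - 0)) has_contour_integral (2 * of_real pi * \<i> * g 0)) (circlepath 0 1)"
    by (rule Cauchy_integral_circlepath_simple) (use assms in auto)
  then have "((\<lambda>t. g (circlepath 0 1 t) / circlepath 0 1 t * (2 * pi * \<i> * circlepath 0 1 t))
      has_integral (2 * of_real pi * \<i> * g 0)) {0..1}"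
    by (simp add: has_contour_integral vector_derivative_circlepath) (simp add: circlepath mult_ac)
  then have "((\<lambda>t. 2 * pi * \<i> * g (cis (2 * pi * t))) has_integral (2 * pi * \<i> * g 0)) {0..1}"
    by (simp add: eq mult_ac)
  from has_integral_mult_right[OF this, of "1 / (2 * pi * \<i>)"] show ?thesis
    by (simp add: field_simps)
qed

text \<open>\<open>f\<close> has to agree with Re g on the circle only, so a kernel may be rewritten
  there by |u| = 1 before it is extended holomorphically.\<close>

lemma nn_integral_circle_mean:
  assumes "g holomorphic_on cball 0 1" "\<And>u. cmod u = 1 \<Longrightarrow> 0 \<le> Re (g u)"
    and "\<And>u. cmod u = 1 \<Longrightarrow> f u = ennreal (Re (g u))"
  shows "(\<integral>\<^sup>+t. f (cis (2 * pi * t)) * indicator {0..1} t \<partial>lborel) = ennreal (Re (g 0))"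
proof -
  have "((\<lambda>t. Re (g (cis (2 * pi * t)))) has_integral Re (g 0)) {0..1}"
    using has_integral_linear[OF has_integral_circle_mean[OF assms(1)] bounded_linear_Re]
    by (simp add: o_def)
  then have "(\<integral>\<^sup>+t. ennreal (Re (g (cis (2 * pi * t)))) * indicator {0..1} t \<partial>lborel) =
      ennreal (Re (g 0))"
    by (intro nn_integral_has_integral_lebesgue') (simp_all add: assms)
  then show ?thesis by (simp add: assms)
qed

lemma borel_measurable_cnj [measurable]:
  assumes "f \<in> borel_measurable M"
  shows "(\<lambda>x. cnj (f x)) \<in> borel_measurable M"
  using measurable_compose[OF assms borel_measurable_continuous_onI[of cnj]]
  by (simp add: continuous_on_cnj)

lemma measurable_log_kernel [measurable]:
  assumes [measurable]: "f \<in> borel_measurable M" "g \<in> borel_measurable M"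
  shows "(\<lambda>x. log_kernel (f x) (g x)) \<in> borel_measurable M"
  unfolding log_kernel_def by measurable

text \<open>Inside the disc the right side is nonnegative, so the quotient in the logarithmic kernel
  has modulus at least 1.\<close>

lemma norm_one_minus_cnj_mult:
  "(cmod (1 - cnj w * z))\<^sup>2 - (cmod (z - w))\<^sup>2 = (1 - (cmod z)\<^sup>2) * (1 - (cmod w)\<^sup>2)"
  unfolding cmod_power2 by (simp add: power2_eq_square algebra_simps)

text \<open>Splitting the logarithm exposes a real part of holomorphic logarithms. The nonnegativity
  shows that \<open>ennreal\<close> truncates nothing.\<close>

lemma log_kernel_eq:
  assumes "cmod z < 1" "cmod \<zeta> < 1" "z \<noteq> \<zeta>"
  shows "log_kernel z \<zeta> = ennreal (2 * ln (cmod (1 - cnj \<zeta> * z)) - 2 * ln (cmod (z - \<zeta>)))"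
    and "0 \<le> 2 * ln (cmod (1 - cnj \<zeta> * z)) - 2 * ln (cmod (z - \<zeta>))"
proof -
  have "(cmod z)\<^sup>2 \<le> 1" "(cmod \<zeta>)\<^sup>2 \<le> 1" using assms by (simp_all add: power_le_one)
  then have "(cmod (z - \<zeta>))\<^sup>2 \<le> (cmod (1 - cnj \<zeta> * z))\<^sup>2"
    using norm_one_minus_cnj_mult[of \<zeta> z] mult_nonneg_nonneg[of "1 - (cmod z)\<^sup>2" "1 - (cmod \<zeta>)\<^sup>2"]
    by linarith
  then have le: "cmod (z - \<zeta>) \<le> cmod (1 - cnj \<zeta> * z)" by (rule power2_le_imp_le) simp
  moreover have pos: "0 < cmod (z - \<zeta>)" using assms by simp
  ultimately show "0 \<le> 2 * ln (cmod (1 - cnj \<zeta> * z)) - 2 * ln (cmod (z - \<zeta>))"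
    using ln_mono[of "cmod (z - \<zeta>)"] by simp
  have "ln ((cmod ((1 - cnj \<zeta> * z) / (z - \<zeta>)))\<^sup>2) =
      2 * ln (cmod (1 - cnj \<zeta> * z) / cmod (z - \<zeta>))"
    using le pos by (subst ln_realpow) (auto simp: norm_divide)
  also have "\<dots> = 2 * ln (cmod (1 - cnj \<zeta> * z)) - 2 * ln (cmod (z - \<zeta>))"
    using le pos by (subst ln_div) auto
  finally show "log_kernel z \<zeta> = ennreal (2 * ln (cmod (1 - cnj \<zeta> * z)) - 2 * ln (cmod (z - \<zeta>)))"
    using assms by (simp add: log_kernel_def)
qed

lemma Re_one_minus_mult_pos:
  assumes "cmod a < 1" "cmod u \<le> 1"
  shows "0 < Re (1 - a * u)"
proof -
  have "cmod (a * u) \<le> cmod a * 1" unfolding norm_mult using assms by (intro mult_left_mono) auto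
  then show ?thesis using complex_Re_le_cmod[of "a * u"] assms by simp
qed

text \<open>The argument of \<open>Ln\<close> stays in the right half plane, away from the branch
  cut.\<close>

lemma holomorphic_Ln_one_minus_mult:
  assumes "cmod a < 1"
  shows "(\<lambda>u. Ln (1 - a * u)) holomorphic_on cball 0 1"
proof (intro holomorphic_intros)
  show "1 - a * u \<notin> \<real>\<^sub>\<le>\<^sub>0" if "u \<in> cball 0 1" for u
    using Re_one_minus_mult_pos[OF assms, of u] that by (auto simp: complex_nonpos_Reals_iff)
qed

text \<open>On |u| = 1 the distance |u z - \<zeta>| is c |1 - b u| with c the larger of the two
  moduli and |b| < 1. The kernel is then the real part of a holomorphic function of u, and the mean
  is its value at 0. Equal moduli would give |b| = 1.\<close>

lemma circle_mean_log_kernel: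
  assumes z: "cmod z < 1" and w: "cmod \<zeta> < 1" and ne: "cmod z \<noteq> cmod \<zeta>"
  shows "(\<integral>\<^sup>+t. log_kernel (cis (2 * pi * t) * z) \<zeta> * indicator {0..1} t \<partial>lborel) =
    ennreal (- ln (max ((cmod z)\<^sup>2) ((cmod \<zeta>)\<^sup>2)))"
proof -
  have "\<exists>b c. cmod b < 1 \<and> 0 < c \<and> c\<^sup>2 = max ((cmod z)\<^sup>2) ((cmod \<zeta>)\<^sup>2) \<and>
      (\<forall>u. cmod u = 1 \<longrightarrow> cmod (u * z - \<zeta>) = c * cmod (1 - b * u))"
  proof (cases "cmod z < cmod \<zeta>")
    case True
    then have "\<zeta> \<noteq> 0" by auto
    have "cmod (u * z - \<zeta>) = cmod \<zeta> * cmod (1 - z / \<zeta> * u)" for u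
    proof -
      have "u * z - \<zeta> = - (\<zeta> * (1 - z / \<zeta> * u))"
        using \<open>\<zeta> \<noteq> 0\<close> by (simp add: field_simps)
      then show ?thesis by (simp only: norm_minus_cancel norm_mult)
    qed
    moreover have "(cmod z)\<^sup>2 \<le> (cmod \<zeta>)\<^sup>2" using True by (simp add: power_mono)
    ultimately show ?thesis
      using True \<open>\<zeta> \<noteq> 0\<close>
      by (intro exI[of _ "z / \<zeta>"] exI[of _ "cmod \<zeta>"]) (simp add: norm_divide max_def)
  next
    case False
    with ne have lt: "cmod \<zeta> < cmod z" by simp
    then have "z \<noteq> 0" by auto
    \<comment> \<open>The zero \<open>\<zeta> / z\<close> in a variable of modulus 1 lies inside the
      disc; factoring out \<open>u\<close> and conjugating reflects it to the outside without
      changing moduli on the circle.\<close>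
    have "cmod (u * z - \<zeta>) = cmod z * cmod (1 - cnj (\<zeta> / z) * u)" if "cmod u = 1" for u
    proof -
      have "u * cnj u = 1" using that by (simp add: complex_norm_square[symmetric])
      then have "u * (1 - \<zeta> / z * cnj u) * z = u * z - \<zeta>"
        using \<open>z \<noteq> 0\<close> by (simp add: field_simps)
      then have "cmod (u * z - \<zeta>) = cmod u * cmod (1 - \<zeta> / z * cnj u) * cmod z"
        by (metis norm_mult)
      also have "cmod (1 - \<zeta> / z * cnj u) = cmod (cnj (1 - \<zeta> / z * cnj u))"
        by (simp only: complex_mod_cnj)
      finally show ?thesis using that by simp
    qed
    moreover have "(cmod \<zeta>)\<^sup>2 \<le> (cmod z)\<^sup>2" using lt by (simp add: power_mono)
    ultimately show ?thesis
      using lt \<open>z \<noteq> 0\<close>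
      by (intro exI[of _ "cnj (\<zeta> / z)"] exI[of _ "cmod z"]) (simp add: norm_divide max_def)
  qed
  then obtain b c where b: "cmod b < 1" and c: "0 < c" "c\<^sup>2 = max ((cmod z)\<^sup>2) ((cmod \<zeta>)\<^sup>2)"
    and bc: "\<And>u. cmod u = 1 \<Longrightarrow> cmod (u * z - \<zeta>) = c * cmod (1 - b * u)"
    by blast
  have a: "cmod (cnj \<zeta> * z) < 1"
    using z w mult_right_mono[of "cmod \<zeta>" 1 "cmod z"] by (simp add: norm_mult)
  \<comment> \<open>The two logarithms vanish at u = 0, so the mean is the constant term -2 ln
    c.\<close>
  define g where "g u = 2 * Ln (1 - cnj \<zeta> * z * u) - 2 * Ln (1 - b * u) - of_real (2 * ln c)" for u
  have Re_g: "Re (g u) = 2 * ln (cmod (1 - cnj \<zeta> * (u * z))) - 2 * ln (cmod (u * z - \<zeta>))"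
    if "cmod u = 1" for u
  proof -
    have "1 - cnj \<zeta> * z * u \<noteq> 0" "1 - b * u \<noteq> 0"
      using Re_one_minus_mult_pos[OF a, of u] Re_one_minus_mult_pos[OF b, of u] that
      by (metis less_irrefl order_refl zero_complex.sel(1))+
    then show ?thesis
      using c(1) by (simp add: g_def bc[OF that] ln_mult mult_ac)
  qed
  have "(\<integral>\<^sup>+t. log_kernel (cis (2 * pi * t) * z) \<zeta> * indicator {0..1} t \<partial>lborel) = ennreal (Re (g 0))"
  proof (rule nn_integral_circle_mean)
    show "g holomorphic_on cball 0 1"
      unfolding g_def by (intro holomorphic_intros holomorphic_Ln_one_minus_mult a b)
    fix u :: complex assume u: "cmod u = 1"
    have "cmod (u * z) < 1" "u * z \<noteq> \<zeta>" using u z ne by (auto simp: norm_mult)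
    then show "0 \<le> Re (g u)" "log_kernel (u * z) \<zeta> = ennreal (Re (g u))"
      using log_kernel_eq[of "u * z" \<zeta>] w Re_g[OF u] by simp_all
  qed
  also have "Re (g 0) = - ln (max ((cmod z)\<^sup>2) ((cmod \<zeta>)\<^sup>2))"
    unfolding c(2)[symmetric] using c(1) by (simp add: g_def ln_realpow)
  finally show ?thesis .
qed

text \<open>As a function of the rotation u the Poisson kernel is the real part of the Herglotz
  kernel, whose value at u = 0 is 1.\<close>

lemma circle_mean_poisson_kernel:
  assumes z: "cmod z < 1" and w: "cmod \<zeta> = 1"
  shows "(\<integral>\<^sup>+t. ennreal ((1 - (cmod (cis (2 * pi * t) * z))\<^sup>2) / (cmod (\<zeta> - cis (2 * pi * t) * z))\<^sup>2) *
    indicator {0..1} t \<partial>lborel) = 1"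
proof -
  define g where "g u = (\<zeta> + u * z) / (\<zeta> - u * z)" for u
  have lt: "cmod (u * z) < 1" if "cmod u \<le> 1" for u
  proof -
    have "cmod (u * z) \<le> 1 * cmod z" unfolding norm_mult using that by (intro mult_right_mono) auto
    then show ?thesis using z by simp
  qed
  have Re_g: "Re (g u) = (1 - (cmod (u * z))\<^sup>2) / (cmod (\<zeta> - u * z))\<^sup>2" for u
  proof -
    have "Re ((\<zeta> + u * z) * cnj (\<zeta> - u * z)) = (cmod \<zeta>)\<^sup>2 - (cmod (u * z))\<^sup>2"
      unfolding cmod_power2 by (simp add: power2_eq_square algebra_simps)
    then show ?thesis
      unfolding g_def complex_div_cnj[of "\<zeta> + u * z"]
      by (simp only: Re_divide_of_real of_real_power[symmetric] w power_one)
  qed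
  have "(\<integral>\<^sup>+t. ennreal ((1 - (cmod (cis (2 * pi * t) * z))\<^sup>2) / (cmod (\<zeta> - cis (2 * pi * t) * z))\<^sup>2) *
      indicator {0..1} t \<partial>lborel) = ennreal (Re (g 0))"
  proof (rule nn_integral_circle_mean)
    show "g holomorphic_on cball 0 1"
      unfolding g_def using lt w by (intro holomorphic_intros) force
    fix u :: complex assume "cmod u = 1"
    then have "(cmod (u * z))\<^sup>2 \<le> 1" using lt[of u] by (simp add: power_le_one)
    then show "0 \<le> Re (g u)" by (simp add: Re_g)
    show "ennreal ((1 - (cmod (u * z))\<^sup>2) / (cmod (\<zeta> - u * z))\<^sup>2) = ennreal (Re (g u))"
      by (simp add: Re_g)
  qed
  also have "g 0 = 1" using w by (auto simp: g_def)
  finally show ?thesis by simp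
qed

lemma has_integral_power_mult_ln_max:
  fixes s :: real
  assumes s: "0 \<le> s" "s < 1"
  shows "((\<lambda>t. (real (Suc m))\<^sup>2 * t ^ m * - ln (max t s)) has_integral 1 - s ^ Suc m) {0..1}"
proof -
  let ?f = "\<lambda>t. (real (Suc m))\<^sup>2 * t ^ m * - ln (max t s)"
  \<comment> \<open>An antiderivative found by parts on each side of s; \<open>max t s\<close> glues
    the two branches continuously. It takes the values 1 at 1 and s^(m+1) at 0.\<close>
  define H where "H t = (max t s) ^ Suc m - real (Suc m) * t ^ m * (t * ln (max t s))" for t
  have "(?f has_integral (H 1 - H 0)) {0..1}"
  proof (rule fundamental_theorem_of_calculus_interior_strong[of "{s}"])
    fix t assume t: "t \<in> {0<..<1} - {s}"
    show "(H has_vector_derivative ?f t) (at t)"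
      unfolding has_real_derivative_iff_has_vector_derivative[symmetric]
    proof (cases "t < s")
      case True
      let ?G = "\<lambda>t. s ^ Suc m - real (Suc m) * t ^ m * (t * ln s)"
      have "(?G has_real_derivative
          0 - real (Suc m) * ln s * (real (Suc m) * t ^ m)) (at t)"
        by (rule derivative_eq_intros refl | simp add: algebra_simps)+
          (cases m, simp_all add: algebra_simps)
      moreover have "0 - real (Suc m) * ln s * (real (Suc m) * t ^ m) = ?f t"
        using True by (simp add: power2_eq_square max_def)
      ultimately have "(?G has_real_derivative ?f t) (at t)" by (simp only:)
      then show "(H has_real_derivative ?f t) (at t)"
        by (rule has_field_derivative_transform_within_open[where S = "{..<s}"])
           (use True in \<open>auto simp: H_def max_def\<close>)
    next
      case False
      with t have "t > s" "t > 0" by auto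
      let ?G = "\<lambda>t. t ^ Suc m - real (Suc m) * (t ^ Suc m * ln t)"
      have "(?G has_real_derivative
          real (Suc m) * t ^ m - real (Suc m) * (real (Suc m) * t ^ m * ln t + t ^ Suc m * (1 / t))) (at t)"
        using \<open>t > 0\<close> by (auto intro!: derivative_eq_intros simp del: power_Suc of_nat_Suc)
      moreover have "real (Suc m) * t ^ m - real (Suc m) * (real (Suc m) * t ^ m * ln t + t ^ Suc m * (1 / t)) = ?f t"
        using \<open>t > 0\<close> \<open>t > s\<close> by (simp add: power2_eq_square max_def algebra_simps)
      ultimately have "(?G has_real_derivative ?f t) (at t)" by (simp only:)
      then show "(H has_real_derivative ?f t) (at t)"
        by (rule has_field_derivative_transform_within_open[where S = "{s<..}"])
           (use \<open>t > s\<close> in \<open>auto simp: H_def max_def\<close>)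
    qed
  next
    \<comment> \<open>Only s = 0 is delicate, where t ln t tends to 0 at 0; this is why
      \<open>H\<close> keeps \<open>t * ln (max t s)\<close> together.\<close>
    have "continuous_on {0..1} (\<lambda>t. t * ln (max t s))"
    proof (cases "s = 0")
      case False
      then show ?thesis using s by (intro continuous_intros) auto
    next
      case True
      have "((\<lambda>t::real. t * ln t) \<longlongrightarrow> 0) (at_right 0)" by real_asymp
      then have "continuous (at 0 within {0..1}) (\<lambda>t::real. t * ln t)"
        by (simp add: continuous_within at_within_Icc_at_right)
      moreover have "continuous (at t within {0..1}) (\<lambda>t. t * ln t)" if "t > 0" for t :: real
        using that by (intro continuous_intros) auto
      ultimately have "continuous_on {0..1} (\<lambda>t::real. t * ln t)"
        unfolding continuous_on_eq_continuous_within by (metis atLeastAtMost_iff le_less)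
      then show ?thesis
        by (rule continuous_on_eq) (simp add: True max_def)
    qed
    moreover have "continuous_on {0..1} (\<lambda>t. (max t s) ^ Suc m - real (Suc m) * t ^ m * L t)"
      if "continuous_on {0..1} L" for L
      using that by (intro continuous_intros)
    ultimately show "continuous_on {0..1} H"
      unfolding H_def[abs_def] by blast
  qed simp_all
  moreover have "H 1 - H 0 = 1 - s ^ Suc m" using s by (simp add: H_def max_def)
  ultimately show ?thesis by simp
qed

lemma nn_integral_area_power_log_kernel:
  assumes "cmod \<zeta> < 1"
  shows "(\<integral>\<^sup>+z. ennreal ((real (Suc m))\<^sup>2 * ((cmod z)\<^sup>2) ^ m) * log_kernel z \<zeta> \<partial>area_measure) =
    ennreal (1 - ((cmod \<zeta>)\<^sup>2) ^ Suc m)"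
proof -
  let ?c = "\<lambda>t. ennreal ((real (Suc m))\<^sup>2 * t ^ m)" and ?s = "(cmod \<zeta>)\<^sup>2"
  have s: "0 \<le> ?s" "?s < 1" using assms by (simp_all add: power_less_one_iff abs_square_less_1)
  have "(\<integral>\<^sup>+z. ?c ((cmod z)\<^sup>2) * log_kernel z \<zeta> \<partial>area_measure) =
      (\<integral>\<^sup>+z. (\<integral>\<^sup>+t. ?c ((cmod (cis (2 * pi * t) * z))\<^sup>2) * log_kernel (cis (2 * pi * t) * z) \<zeta> *
        indicator {0..1} t \<partial>lborel) \<partial>area_measure)"
    by (rule nn_integral_area_circle_average) measurable
  also have "\<dots> = (\<integral>\<^sup>+z. ?c ((cmod z)\<^sup>2) *
      (\<integral>\<^sup>+t. log_kernel (cis (2 * pi * t) * z) \<zeta> * indicator {0..1} t \<partial>lborel) \<partial>area_measure)"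
  proof (intro nn_integral_cong)
    fix z
    have [measurable]: "(\<lambda>t::real. cis (2 * pi * t)) \<in> borel_measurable borel"
      by (intro borel_measurable_continuous_onI continuous_intros)
    show "(\<integral>\<^sup>+t. ?c ((cmod (cis (2 * pi * t) * z))\<^sup>2) * log_kernel (cis (2 * pi * t) * z) \<zeta> *
        indicator {0..1} t \<partial>lborel) =
      ?c ((cmod z)\<^sup>2) * (\<integral>\<^sup>+t. log_kernel (cis (2 * pi * t) * z) \<zeta> * indicator {0..1} t \<partial>lborel)"
      by (subst nn_integral_cmult[symmetric], measurable) (simp add: norm_mult mult.assoc)
  qed
  also have "\<dots> = (\<integral>\<^sup>+z. ?c ((cmod z)\<^sup>2) * ennreal (- ln (max ((cmod z)\<^sup>2) ?s)) \<partial>area_measure)"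
  proof (rule nn_integral_cong_AE)
    have "AE z in area_measure. z \<in> ball 0 1" by (rule AE_uniform_measureI) auto
    \<comment> \<open>The circle |z| = |\<zeta>|, on which the mean was not computed, is
      null.\<close>
    with AE_area_norm_neq[of "cmod \<zeta>"]
    show "AE z in area_measure. ?c ((cmod z)\<^sup>2) *
        (\<integral>\<^sup>+t. log_kernel (cis (2 * pi * t) * z) \<zeta> * indicator {0..1} t \<partial>lborel) =
        ?c ((cmod z)\<^sup>2) * ennreal (- ln (max ((cmod z)\<^sup>2) ?s))"
      by eventually_elim (simp add: circle_mean_log_kernel[OF _ assms])
  qed
  also have "\<dots> = (\<integral>\<^sup>+t. ?c t * ennreal (- ln (max t ?s)) * indicator {0..1} t \<partial>lborel)"
    by (rule nn_integral_area_radial) measurable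
  also have "\<dots> = (\<integral>\<^sup>+t. ennreal ((real (Suc m))\<^sup>2 * t ^ m * - ln (max t ?s)) * indicator {0..1} t \<partial>lborel)"
  proof (intro nn_integral_cong)
    fix t :: real
    show "?c t * ennreal (- ln (max t ?s)) * indicator {0..1} t =
        ennreal ((real (Suc m))\<^sup>2 * t ^ m * - ln (max t ?s)) * indicator {0..1} t"
    proof (cases "t \<in> {0..1}")
      case True
      then have "0 \<le> (real (Suc m))\<^sup>2 * t ^ m" by simp
      then show ?thesis by (simp only: ennreal_mult')
    qed (auto simp: indicator_def)
  qed
  also have "\<dots> = ennreal (1 - ?s ^ Suc m)"
  proof (rule nn_integral_has_integral_lebesgue'[OF _ has_integral_power_mult_ln_max[OF s]])
    fix t :: real assume t: "t \<in> {0..1}"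
    have "ln (max t ?s) \<le> 0"
    \<comment> \<open>When both arguments vanish the default \<open>ln 0 = 0\<close> decides the
      sign.\<close>
    proof (cases "max t ?s = 0")
      case False
      then show ?thesis using t s by (subst ln_le_zero_iff) auto
    qed simp
    then show "0 \<le> (real (Suc m))\<^sup>2 * t ^ m * - ln (max t ?s)"
      using t by (intro mult_nonneg_nonneg) auto
  qed
  finally show ?thesis .
qed

lemma nn_integral_area_power_poisson_kernel:
  assumes "cmod \<zeta> = 1"
  shows "(\<integral>\<^sup>+z. ennreal ((real (Suc m))\<^sup>2 * ((cmod z)\<^sup>2) ^ m) *
    ennreal ((1 - (cmod z)\<^sup>2) / (cmod (\<zeta> - z))\<^sup>2) \<partial>area_measure) = ennreal (real (Suc m))"
proof -
  let ?c = "\<lambda>t. ennreal ((real (Suc m))\<^sup>2 * t ^ m)"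
    and ?P = "\<lambda>z. ennreal ((1 - (cmod z)\<^sup>2) / (cmod (\<zeta> - z))\<^sup>2)"
  have "(\<integral>\<^sup>+z. ?c ((cmod z)\<^sup>2) * ?P z \<partial>area_measure) =
      (\<integral>\<^sup>+z. (\<integral>\<^sup>+t. ?c ((cmod (cis (2 * pi * t) * z))\<^sup>2) * ?P (cis (2 * pi * t) * z) *
        indicator {0..1} t \<partial>lborel) \<partial>area_measure)"
    by (rule nn_integral_area_circle_average) measurable
  also have "\<dots> = (\<integral>\<^sup>+z. ?c ((cmod z)\<^sup>2) *
      (\<integral>\<^sup>+t. ?P (cis (2 * pi * t) * z) * indicator {0..1} t \<partial>lborel) \<partial>area_measure)"
  proof (intro nn_integral_cong)
    fix z
    have [measurable]: "(\<lambda>t::real. cis (2 * pi * t)) \<in> borel_measurable borel"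
      by (intro borel_measurable_continuous_onI continuous_intros)
    show "(\<integral>\<^sup>+t. ?c ((cmod (cis (2 * pi * t) * z))\<^sup>2) * ?P (cis (2 * pi * t) * z) *
        indicator {0..1} t \<partial>lborel) =
      ?c ((cmod z)\<^sup>2) * (\<integral>\<^sup>+t. ?P (cis (2 * pi * t) * z) * indicator {0..1} t \<partial>lborel)"
      by (subst nn_integral_cmult[symmetric], measurable) (simp add: norm_mult mult.assoc)
  qed
  also have "\<dots> = (\<integral>\<^sup>+z. ?c ((cmod z)\<^sup>2) \<partial>area_measure)"
  proof (rule nn_integral_cong_AE)
    have "AE z in area_measure. z \<in> ball 0 1" by (rule AE_uniform_measureI) auto
    then show "AE z in area_measure. ?c ((cmod z)\<^sup>2) *
        (\<integral>\<^sup>+t. ?P (cis (2 * pi * t) * z) * indicator {0..1} t \<partial>lborel) = ?c ((cmod z)\<^sup>2)"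
      by eventually_elim (simp only: circle_mean_poisson_kernel[OF _ assms] mem_ball_0 mult_1_right)
  qed
  also have "\<dots> = (\<integral>\<^sup>+t. ?c t * indicator {0..1} t \<partial>lborel)"
    by (rule nn_integral_area_radial) measurable
  also have "\<dots> = ennreal (real (Suc m))"
  proof (rule nn_integral_has_integral_lebesgue')
    have "((\<lambda>t. (real (Suc m))\<^sup>2 * t ^ m) has_integral
        real (Suc m) * 1 ^ Suc m - real (Suc m) * 0 ^ Suc m) {0..1::real}"
      by (rule fundamental_theorem_of_calculus)
         (auto intro!: derivative_eq_intros simp: power2_eq_square
           simp flip: has_real_derivative_iff_has_vector_derivative simp del: power_Suc of_nat_Suc)
    then show "((\<lambda>t. (real (Suc m))\<^sup>2 * t ^ m) has_integral real (Suc m)) {0..1::real}" by simp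
  qed simp
  finally show ?thesis .
qed

section \<open>Monomials in Dirichlet-type spaces\<close>

text \<open>The potential at z of a unit point mass at \<open>\<zeta>\<close>. Joining the interior
  and boundary terms in one kernel makes the weight a single integral, to which Tonelli applies
  once.\<close>

definition weight_kernel :: "complex \<Rightarrow> complex \<Rightarrow> ennreal" where
  "weight_kernel z \<zeta> = log_kernel z \<zeta> * ennreal (1 / (1 - (cmod \<zeta>)\<^sup>2)) * indicator (ball 0 1) \<zeta> +
    ennreal ((1 - (cmod z)\<^sup>2) / (cmod (\<zeta> - z))\<^sup>2) * indicator (sphere 0 1) \<zeta>"

lemma measurable_weight_kernel [measurable]:
  assumes [measurable]: "f \<in> borel_measurable M" "g \<in> borel_measurable M"
  shows "(\<lambda>x. weight_kernel (f x) (g x)) \<in> borel_measurable M"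
proof -
  have [measurable]: "ball (0::complex) 1 \<in> sets borel" "sphere (0::complex) 1 \<in> sets borel"
    by simp_all
  show ?thesis unfolding weight_kernel_def by measurable
qed

context
  fixes \<rho> :: "complex measure"
  assumes \<rho>: "finite_borel_measure_on_cdisc \<rho>"
begin

lemma sets_cdisc_measure: "sets \<rho> = sets (restrict_space borel (cball 0 1))"
  using \<rho> by (simp add: finite_borel_measure_on_cdisc_def)

lemma space_cdisc_measure: "space \<rho> = cball 0 1"
  using sets_eq_imp_space_eq[OF sets_cdisc_measure] by (simp add: space_restrict_space)

lemma measurable_cdisc_measure: "f \<in> borel_measurable borel \<Longrightarrow> f \<in> borel_measurable \<rho>"
  unfolding measurable_cong_sets[OF sets_cdisc_measure refl] by (rule measurable_restrict_space1)

lemma unit_interval_measure_distr: "unit_interval_measure (distr \<rho> borel (\<lambda>z. (cmod z)\<^sup>2))"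
proof -
  interpret finite_measure \<rho> using \<rho> by (simp add: finite_borel_measure_on_cdisc_def)
  have meas: "(\<lambda>z. (cmod z)\<^sup>2) \<in> borel_measurable \<rho>"
    by (rule measurable_cdisc_measure) measurable
  interpret D: finite_measure "distr \<rho> borel (\<lambda>z. (cmod z)\<^sup>2)"
    by (rule finite_measure_distr[OF meas])
  show ?thesis
  proof
    have "AE z in \<rho>. (cmod z)\<^sup>2 \<in> {0..1}"
      by (rule AE_I2) (simp add: space_cdisc_measure power_le_one)
    then show "AE x in distr \<rho> borel (\<lambda>z. (cmod z)\<^sup>2). x \<in> {0..1}"
      by (subst AE_distr_iff[OF meas]) auto
  qed simp
qed

lemma superharmonic_weight_eq: "superharmonic_weight \<rho> z = (\<integral>\<^sup>+\<zeta>. weight_kernel z \<zeta> \<partial>\<rho>)"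
proof -
  have [measurable]: "ball (0::complex) 1 \<in> sets borel" "sphere (0::complex) 1 \<in> sets borel"
    by simp_all
  show ?thesis
    unfolding superharmonic_weight_def weight_kernel_def
    by (rule nn_integral_add[symmetric]; rule measurable_cdisc_measure; measurable)
qed

text \<open>Joint measurability for Tonelli. As \<open>\<rho>\<close> carries only the trace
  sigma-algebra of the closed disc, it is obtained through the projections.\<close>

lemma measurable_pair_weight_kernel:
  assumes "sets N = sets borel"
  shows "(\<lambda>x. weight_kernel (fst x) (snd x)) \<in> borel_measurable (N \<Otimes>\<^sub>M \<rho>)"
proof (rule measurable_weight_kernel)
  show "fst \<in> borel_measurable (N \<Otimes>\<^sub>M \<rho>)"
    using measurable_fst[of N \<rho>] by (simp cong: measurable_cong_sets add: assms)
  show "snd \<in> borel_measurable (N \<Otimes>\<^sub>M \<rho>)"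
    using measurable_compose[OF measurable_snd measurable_cdisc_measure[of "\<lambda>x. x"]] by simp
qed

lemma measurable_superharmonic_weight: "superharmonic_weight \<rho> \<in> borel_measurable borel"
proof -
  interpret finite_measure \<rho> using \<rho> by (simp add: finite_borel_measure_on_cdisc_def)
  show ?thesis
    unfolding superharmonic_weight_eq[abs_def]
    by (rule borel_measurable_nn_integral)
       (use measurable_pair_weight_kernel[of borel] in \<open>simp add: case_prod_beta'\<close>)
qed

text \<open>The factor before the weight is the squared modulus of the derivative of z^(m+1), so
  exponent m on the left goes with \<open>Suc m\<close> moments on the right.\<close>

lemma nn_integral_area_superharmonic_weight:
  "(\<integral>\<^sup>+z. ennreal ((real (Suc m))\<^sup>2 * ((cmod z)\<^sup>2) ^ m) * superharmonic_weight \<rho> z \<partial>area_measure) =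
    ennreal (moment_sum (distr \<rho> borel (\<lambda>z. (cmod z)\<^sup>2)) (Suc m))"
proof -
  interpret finite_measure \<rho> using \<rho> by (simp add: finite_borel_measure_on_cdisc_def)
  interpret D: unit_interval_measure "distr \<rho> borel (\<lambda>z. (cmod z)\<^sup>2)"
    by (rule unit_interval_measure_distr)
  interpret A: prob_space area_measure by (rule prob_space_area_measure)
  interpret P: pair_sigma_finite area_measure \<rho>
    by (intro pair_sigma_finite.intro A.sigma_finite_measure_axioms sigma_finite_measure_axioms)
  define c where "c z = ennreal ((real (Suc m))\<^sup>2 * ((cmod z)\<^sup>2) ^ m)" for z :: complex
  have [measurable]: "c \<in> borel_measurable borel" unfolding c_def by measurable
  have "(\<integral>\<^sup>+z. c z * superharmonic_weight \<rho> z \<partial>area_measure) =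
      (\<integral>\<^sup>+z. (\<integral>\<^sup>+\<zeta>. c z * weight_kernel z \<zeta> \<partial>\<rho>) \<partial>area_measure)"
  proof (rule nn_integral_cong)
    fix z
    have "weight_kernel z \<in> borel_measurable \<rho>"
      by (rule measurable_cdisc_measure) measurable
    then show "c z * superharmonic_weight \<rho> z = (\<integral>\<^sup>+\<zeta>. c z * weight_kernel z \<zeta> \<partial>\<rho>)"
      by (simp add: superharmonic_weight_eq nn_integral_cmult)
  qed
  also have "\<dots> = (\<integral>\<^sup>+\<zeta>. (\<integral>\<^sup>+z. c z * weight_kernel z \<zeta> \<partial>area_measure) \<partial>\<rho>)"
  proof (rule P.Fubini'[symmetric])
    have [measurable]: "(\<lambda>x. c (fst x)) \<in> borel_measurable (area_measure \<Otimes>\<^sub>M \<rho>)"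
      using measurable_compose[OF measurable_fst, of c area_measure borel \<rho>]
      by (simp cong: measurable_cong_sets)
    show "(\<lambda>(z, \<zeta>). c z * weight_kernel z \<zeta>) \<in> borel_measurable (area_measure \<Otimes>\<^sub>M \<rho>)"
      unfolding case_prod_beta'
      by (intro borel_measurable_times_ennreal measurable_pair_weight_kernel) (fact, simp)
  qed
  also have "\<dots> = (\<integral>\<^sup>+\<zeta>. ennreal (\<Sum>k<Suc m. ((cmod \<zeta>)\<^sup>2) ^ k) \<partial>\<rho>)"
  proof (rule nn_integral_cong)
    fix \<zeta> assume "\<zeta> \<in> space \<rho>"
    then have "cmod \<zeta> < 1 \<or> cmod \<zeta> = 1" by (auto simp: space_cdisc_measure)
    then show "(\<integral>\<^sup>+z. c z * weight_kernel z \<zeta> \<partial>area_measure) = ennreal (\<Sum>k<Suc m. ((cmod \<zeta>)\<^sup>2) ^ k)"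
    proof
      assume 1: "cmod \<zeta> < 1"
      let ?s = "(cmod \<zeta>)\<^sup>2"
      have s: "?s < 1" using 1 by (simp add: power_less_one_iff abs_square_less_1)
      have "(\<integral>\<^sup>+z. c z * weight_kernel z \<zeta> \<partial>area_measure) =
          (\<integral>\<^sup>+z. c z * log_kernel z \<zeta> * ennreal (1 / (1 - ?s)) \<partial>area_measure)"
        using 1 by (simp add: weight_kernel_def mult.assoc)
      also have "\<dots> = ennreal (1 - ?s ^ Suc m) * ennreal (1 / (1 - ?s))"
        by (subst nn_integral_multc)
           (measurable, simp only: c_def nn_integral_area_power_log_kernel[OF 1])
      also have "\<dots> = ennreal (\<Sum>k<Suc m. ?s ^ k)"
      proof -
        \<comment> \<open>The factor 1/(1 - |\<zeta>|^2) of the potential produces a geometric sum,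
          whose value at |\<zeta>| = 1 is the one found for boundary points.\<close>
        have "(1 - ?s ^ Suc m) * (1 / (1 - ?s)) = (\<Sum>k<Suc m. ?s ^ k)"
          using s by (simp only: one_diff_power_eq[of ?s "Suc m"]) simp
        moreover have "0 \<le> 1 / (1 - ?s)" using s by simp
        ultimately show ?thesis by (metis ennreal_mult'')
      qed
      finally show ?thesis .
    next
      assume 2: "cmod \<zeta> = 1"
      then have "(\<integral>\<^sup>+z. c z * weight_kernel z \<zeta> \<partial>area_measure) = ennreal (real (Suc m))"
        using nn_integral_area_power_poisson_kernel[OF 2, of m] by (simp add: weight_kernel_def c_def)
      then show ?thesis by (simp add: 2)
    qed
  qed
  also have "\<dots> = (\<integral>\<^sup>+t. ennreal (\<Sum>k<Suc m. t ^ k) \<partial>distr \<rho> borel (\<lambda>z. (cmod z)\<^sup>2))"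
    by (subst nn_integral_distr) (measurable, auto intro!: measurable_cdisc_measure)
  also have "\<dots> = ennreal (moment_sum (distr \<rho> borel (\<lambda>z. (cmod z)\<^sup>2)) (Suc m))"
    unfolding moment_sum_def
  proof (rule nn_integral_eq_integral[OF D.integrable_geometric_sum])
    show "AE t in distr \<rho> borel (\<lambda>z. (cmod z)\<^sup>2). 0 \<le> (\<Sum>k<Suc m. t ^ k)"
      using D.AE_M by eventually_elim (rule D.geometric_sum_bounds)
  qed
  finally show ?thesis by (simp add: c_def)
qed

lemma nn_integral_area_deriv_power:
  assumes F: "\<And>w. w \<in> ball 0 1 \<Longrightarrow> F w = c * w ^ n"
  shows "(\<integral>\<^sup>+z. ennreal ((cmod (deriv F z))\<^sup>2) * superharmonic_weight \<rho> z \<partial>area_measure) =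
    ennreal ((cmod c)\<^sup>2 * moment_sum (distr \<rho> borel (\<lambda>z. (cmod z)\<^sup>2)) n)"
proof -
  have deriv_F: "deriv F z = c * (of_nat n * z ^ (n - 1))" if "z \<in> ball 0 1" for z
  proof -
    have "deriv F z = deriv (\<lambda>w. c * w ^ n) z"
      using eventually_nhds_in_open[OF open_ball that]
      by (intro deriv_cong_ev refl) (auto elim!: eventually_mono intro: F)
    also have "\<dots> = c * (of_nat n * z ^ (n - 1))"
      by (rule DERIV_imp_deriv) (auto intro!: derivative_eq_intros)
    finally show ?thesis .
  qed
  have AE_ball: "AE z in area_measure. z \<in> ball 0 1" by (rule AE_uniform_measureI) auto
  show ?thesis
  proof (cases n)
    \<comment> \<open>The derivative vanishes, and in \<open>ennreal\<close> the product with the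
      weight is 0 even where the weight is infinite.\<close>
    case 0
    have "(\<integral>\<^sup>+z. ennreal ((cmod (deriv F z))\<^sup>2) * superharmonic_weight \<rho> z \<partial>area_measure) =
        (\<integral>\<^sup>+z. 0 \<partial>area_measure)"
      by (rule nn_integral_cong_AE) (use AE_ball in eventually_elim, simp only: deriv_F, simp add: 0)
    then show ?thesis by (simp add: 0 moment_sum_def)
  next
    case (Suc m)
    let ?c = "\<lambda>z. ennreal ((real (Suc m))\<^sup>2 * ((cmod z)\<^sup>2) ^ m)"
    have "(\<integral>\<^sup>+z. ennreal ((cmod (deriv F z))\<^sup>2) * superharmonic_weight \<rho> z \<partial>area_measure) =
        (\<integral>\<^sup>+z. ennreal ((cmod c)\<^sup>2) * (?c z * superharmonic_weight \<rho> z) \<partial>area_measure)"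
    proof (rule nn_integral_cong_AE)
      show "AE z in area_measure. ennreal ((cmod (deriv F z))\<^sup>2) * superharmonic_weight \<rho> z =
          ennreal ((cmod c)\<^sup>2) * (?c z * superharmonic_weight \<rho> z)"
        using AE_ball
      proof eventually_elim
        case (elim z)
        have "(cmod (deriv F z))\<^sup>2 = (cmod c)\<^sup>2 * ((real (Suc m))\<^sup>2 * ((cmod z)\<^sup>2) ^ m)"
          unfolding deriv_F[OF elim] Suc
          by (simp add: norm_mult norm_power power_mult_distrib power_mult[symmetric] mult.commute
              del: of_nat_Suc)
        then show ?case by (simp only: ennreal_mult' zero_le_power2 mult.assoc)
      qed
    qed
    also have "\<dots> = ennreal ((cmod c)\<^sup>2) *
        ennreal (moment_sum (distr \<rho> borel (\<lambda>z. (cmod z)\<^sup>2)) (Suc m))"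
    proof (subst nn_integral_cmult)
      have [measurable]: "superharmonic_weight \<rho> \<in> borel_measurable borel"
        by (rule measurable_superharmonic_weight)
      show "(\<lambda>z. ?c z * superharmonic_weight \<rho> z) \<in> borel_measurable area_measure"
        by measurable
    qed (simp only: nn_integral_area_superharmonic_weight)
    finally show ?thesis by (simp add: Suc ennreal_mult')
  qed
qed

end

section \<open>Norms of the monomials on the bidisc\<close>

definition monomial_fun :: "nat \<Rightarrow> nat \<Rightarrow> complex \<times> complex \<Rightarrow> complex" where
  "monomial_fun i j = (\<lambda>z\<in>bidisc. fst z ^ i * snd z ^ j)"

lemma monomial_fun_eq: "cmod z < 1 \<Longrightarrow> cmod w < 1 \<Longrightarrow> monomial_fun i j (z, w) = z ^ i * w ^ j"
  by (simp add: monomial_fun_def bidisc_def)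

lemma mult_funpow_one_fun: "(mult_z1 ^^ i) ((mult_z2 ^^ j) one_fun) = monomial_fun i j"
proof (induction i)
  case 0
  show ?case
    by (induction j) (auto simp: one_fun_def mult_z2_def monomial_fun_def fun_eq_iff)
next
  case (Suc i)
  then show ?case by (auto simp: mult_z1_def monomial_fun_def fun_eq_iff)
qed

lemma higher_deriv_power_0:
  "(deriv ^^ k) (\<lambda>w. w ^ n) (0 :: complex) = (if k = n then fact n else 0)"
proof -
  have "(deriv ^^ k) (\<lambda>w. w ^ n) (0 :: complex) =
      pochhammer (of_nat (Suc n - k)) k * 0 ^ (n - k)"
    using higher_deriv_power[of k 0 n "0 :: complex"] by simp
  \<comment> \<open>Truncated subtraction makes the Pochhammer symbol start at 0, hence vanish, for
    k > n; for k < n the power of 0 vanishes instead.\<close>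
  moreover have "n < k \<Longrightarrow> Suc n - k = 0" by simp
  ultimately show ?thesis
    by (cases k n rule: linorder_cases)
       (auto simp: pochhammer_fact[symmetric] pochhammer_0_left)
qed

lemma higher_deriv_cmult_power_0:
  "(deriv ^^ k) (\<lambda>w. c * w ^ n) (0 :: complex) = (if k = n then c * fact n else 0)"
proof -
  have "(deriv ^^ k) (\<lambda>w. c * w ^ n) 0 = c * (deriv ^^ k) (\<lambda>w. w ^ n) 0"
    by (rule higher_deriv_cmult[of _ UNIV]) (auto intro!: holomorphic_intros)
  then show ?thesis by (simp add: higher_deriv_power_0)
qed

text \<open>Iterated derivatives at 0 depend only on a neighbourhood, where the cut-off function is
  the polynomial.\<close>

lemma taylor_coeff_monomial_fun:
  "taylor_coeff (monomial_fun i j) \<alpha> = (if \<alpha> = (i, j) then 1 else 0)"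
proof -
  have nhds: "\<forall>\<^sub>F w in nhds (0 :: complex). cmod w < 1"
    using eventually_nhds_in_open[of "ball 0 1" "0 :: complex"] by simp
  let ?c = "if snd \<alpha> = j then fact j else 0 :: complex"
  have inner: "(deriv ^^ snd \<alpha>) (\<lambda>z2. monomial_fun i j (z1, z2)) 0 = ?c * z1 ^ i"
    if "cmod z1 < 1" for z1
  proof -
    have "(deriv ^^ snd \<alpha>) (\<lambda>z2. monomial_fun i j (z1, z2)) 0 =
        (deriv ^^ snd \<alpha>) (\<lambda>z2. z1 ^ i * z2 ^ j) 0"
      using nhds
      by (intro higher_deriv_cong_ev refl) (auto elim!: eventually_mono simp: monomial_fun_eq that)
    then show ?thesis by (simp add: higher_deriv_cmult_power_0)
  qed
  have "(deriv ^^ fst \<alpha>) (\<lambda>z1. (deriv ^^ snd \<alpha>) (\<lambda>z2. monomial_fun i j (z1, z2)) 0) 0 =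
      (deriv ^^ fst \<alpha>) (\<lambda>z1. ?c * z1 ^ i) 0"
    using nhds by (intro higher_deriv_cong_ev refl) (auto elim!: eventually_mono simp only: inner)
  also have "\<dots> = (if fst \<alpha> = i then ?c * fact i else 0)"
    by (rule higher_deriv_cmult_power_0)
  finally show ?thesis by (auto simp: taylor_coeff_def prod_eq_iff)
qed

lemma has_sum_taylor_coeff_monomial_fun:
  "((\<lambda>\<alpha>. (cmod (taylor_coeff (monomial_fun i j) \<alpha>))\<^sup>2) has_sum 1) UNIV"
  by (rule has_sum_finite_neutralI[of "{(i, j)}"]) (auto simp: taylor_coeff_monomial_fun)

lemma hardy_norm_sq_monomial_fun: "hardy_norm_sq (monomial_fun i j) = 1"
  unfolding hardy_norm_sq_def by (rule infsumI[OF has_sum_taylor_coeff_monomial_fun])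

lemma holomorphic_monomial_fun: "holomorphic_on_bidisc (monomial_fun i j)"
  unfolding holomorphic_on_bidisc_def
proof
  fix z assume z: "z \<in> bidisc"
  let ?a = "of_nat i * fst z ^ (i - 1) * snd z ^ j" and ?b = "fst z ^ i * (of_nat j * snd z ^ (j - 1))"
  have "((\<lambda>w. fst w ^ i * snd w ^ j) has_derivative (\<lambda>h. ?a * fst h + ?b * snd h)) (at z)"
    by (rule derivative_eq_intros refl | rule ext)+ (simp add: algebra_simps)
  moreover have "open bidisc" by (simp add: bidisc_def open_Times)
  ultimately have "(monomial_fun i j has_derivative (\<lambda>h. ?a * fst h + ?b * snd h)) (at z)"
    by (rule has_derivative_transform_within_open[OF _ _ z]) (simp only: monomial_fun_def restrict_apply')
  then show "\<exists>a b. (monomial_fun i j has_derivative (\<lambda>h. a * fst h + b * snd h)) (at z)" by blast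
qed

lemma monomial_fun_in_hardy_space: "monomial_fun i j \<in> hardy_space"
  using has_sum_taylor_coeff_monomial_fun holomorphic_monomial_fun
  by (auto simp: hardy_space_def summable_on_def monomial_fun_def)

lemma SUP_power_mult_ennreal:
  assumes "0 \<le> c"
  shows "(SUP r\<in>{0<..<1::real}. ennreal (r ^ k * c)) = ennreal c"
proof (rule antisym)
  show "(SUP r\<in>{0<..<1::real}. ennreal (r ^ k * c)) \<le> ennreal c"
    using assms by (intro SUP_least ennreal_leI mult_left_le_one_le) (auto simp: power_le_one)
  have "((\<lambda>r::real. r ^ k * c) \<longlongrightarrow> 1 ^ k * c) (at_left 1)"
    by (intro tendsto_intros)
  then have "((\<lambda>r::real. ennreal (r ^ k * c)) \<longlongrightarrow> ennreal c) (at_left 1)"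
    by (intro tendsto_ennrealI) simp
  moreover have "\<forall>\<^sub>F r in at_left (1::real). ennreal (r ^ k * c) \<le> (SUP r\<in>{0<..<1::real}. ennreal (r ^ k * c))"
  proof -
    have "\<forall>\<^sub>F r in at_left (1::real). r \<in> {0<..<1}"
      by (rule eventually_at_left_real) simp
    then show ?thesis by eventually_elim (rule SUP_upper)
  qed
  ultimately show "ennreal c \<le> (SUP r\<in>{0<..<1::real}. ennreal (r ^ k * c))"
    by (rule tendsto_upperbound) (rule trivial_limit_at_left_real)
qed

lemma dirichlet_integral_monomial_fun:
  assumes \<rho>1: "finite_borel_measure_on_cdisc \<rho>1" and \<rho>2: "finite_borel_measure_on_cdisc \<rho>2"
  shows "dirichlet_integral \<rho>1 \<rho>2 (monomial_fun i j) =
    ennreal (moment_sum (distr \<rho>1 borel (\<lambda>z. (cmod z)\<^sup>2)) i +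
      moment_sum (distr \<rho>2 borel (\<lambda>z. (cmod z)\<^sup>2)) j)"
proof -
  let ?m1 = "moment_sum (distr \<rho>1 borel (\<lambda>z. (cmod z)\<^sup>2)) i"
    and ?m2 = "moment_sum (distr \<rho>2 borel (\<lambda>z. (cmod z)\<^sup>2)) j"
  interpret M: unit_interval_measure "distr \<rho>1 borel (\<lambda>z. (cmod z)\<^sup>2)"
    by (rule unit_interval_measure_distr[OF \<rho>1])
  interpret N: unit_interval_measure "distr \<rho>2 borel (\<lambda>z. (cmod z)\<^sup>2)"
    by (rule unit_interval_measure_distr[OF \<rho>2])
  interpret T: prob_space angle_measure
    by (rule prob_space_uniform_measure) simp_all
  have cmod: "cmod (rcis r \<theta>) < 1" "(cmod (rcis r \<theta> ^ k))\<^sup>2 = r ^ (2 * k)"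
    if "r \<in> {0<..<1}" for r \<theta> k
    using that by (simp_all add: norm_power power_mult[symmetric] mult.commute)
  have "(\<integral>\<^sup>+z1. ennreal ((cmod (deriv (\<lambda>w. monomial_fun i j (w, rcis r \<theta>)) z1))\<^sup>2) *
      superharmonic_weight \<rho>1 z1 \<partial>area_measure) = ennreal (r ^ (2 * j) * ?m1)"
    if "r \<in> {0<..<1}" for r \<theta>
    using nn_integral_area_deriv_power[OF \<rho>1,
        of "\<lambda>w. monomial_fun i j (w, rcis r \<theta>)" "rcis r \<theta> ^ j" i] cmod[OF that]
    by (simp add: monomial_fun_eq)
  moreover have "(\<integral>\<^sup>+z2. ennreal ((cmod (deriv (\<lambda>w. monomial_fun i j (rcis r \<theta>, w)) z2))\<^sup>2) *
      superharmonic_weight \<rho>2 z2 \<partial>area_measure) = ennreal (r ^ (2 * i) * ?m2)"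
    if "r \<in> {0<..<1}" for r \<theta>
    using nn_integral_area_deriv_power[OF \<rho>2,
        of "\<lambda>w. monomial_fun i j (rcis r \<theta>, w)" "rcis r \<theta> ^ i" j] cmod[OF that]
    by (simp add: monomial_fun_eq)
  ultimately have "dirichlet_integral \<rho>1 \<rho>2 (monomial_fun i j) =
      (SUP r\<in>{0<..<1}. ennreal (r ^ (2 * j) * ?m1)) + (SUP r\<in>{0<..<1}. ennreal (r ^ (2 * i) * ?m2))"
    unfolding dirichlet_integral_def by (simp add: T.emeasure_space_1 cong: SUP_cong_simp)
  also have "\<dots> = ennreal ?m1 + ennreal ?m2"
    by (simp only: SUP_power_mult_ennreal M.moment_sum_nonneg N.moment_sum_nonneg)
  finally show ?thesis by (simp add: ennreal_plus M.moment_sum_nonneg N.moment_sum_nonneg)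
qed

theorem theorem1p4:
  fixes \<rho>1 \<rho>2 :: "complex measure" and S :: "complex \<Rightarrow> real"
    and \<nu> :: "(real \<times> real) measure"
  assumes "finite_borel_measure_on_cdisc \<rho>1"
    and "finite_borel_measure_on_cdisc \<rho>2"
  defines "S \<equiv> \<lambda>z. (cmod z)\<^sup>2"
  shows "levy_measure_of_pair (dirichlet_space \<rho>1 \<rho>2) (dirichlet_norm \<rho>1 \<rho>2)
           (mult_z1, mult_z2) one_fun \<nu> \<longleftrightarrow>
         \<nu> = add_measure
               (density (restrict_space (distr \<rho>1 borel S \<Otimes>\<^sub>M return borel 1) punctured_square)
                  (\<lambda>x. ennreal (1 / (1 - fst x))))
               (density (restrict_space (return borel 1 \<Otimes>\<^sub>M distr \<rho>2 borel S) punctured_square)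
                  (\<lambda>x. ennreal (1 / (1 - snd x))))"
proof -
  interpret edge_measures "distr \<rho>1 borel S" "distr \<rho>2 borel S"
    unfolding S_def
    by (intro edge_measures.intro unit_interval_measure_distr assms(1,2))
  note integral = dirichlet_integral_monomial_fun[OF assms(1,2), folded S_def]
  have "monomial_fun i j \<in> dirichlet_space \<rho>1 \<rho>2" for i j
    by (simp add: dirichlet_space_def monomial_fun_in_hardy_space integral)
  \<comment> \<open>Nonnegativity of the moment sums lets the square undo \<open>sqrt\<close>, and
    keeping both sums under one \<open>ennreal\<close> lets \<open>enn2real\<close> cancel
    it.\<close>
  moreover have "(dirichlet_norm \<rho>1 \<rho>2 (monomial_fun i j))\<^sup>2 =
      1 + moment_sum (distr \<rho>1 borel S) i + moment_sum (distr \<rho>2 borel S) j" for i j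
    using M.moment_sum_nonneg[of i] N.moment_sum_nonneg[of j]
    by (simp add: dirichlet_norm_def hardy_norm_sq_monomial_fun integral del: ennreal_plus)
  ultimately show ?thesis
    using levy_measure_of_moment_sums_iff[of \<nu>]
    by (simp add: levy_measure_of_pair_def mult_funpow_one_fun edge_measure_def)
qed

end
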